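(* Let $B$ be the marginal-cost dual-balancing policy, i.e. the ordering policy which in every period $t$, given the current inventory vector $\mathbf{x}_t$ and information $f_t$, orders a quantity $q_t^B\ge 0$ solving $P_t(\mathbf{x}_t,f_t,q_t)=H_t(\mathbf{x}_t,f_t,q_t)+W_t(\mathbf{x}_t,f_t,q_t)$. Let $BA$ be an optimal base-stock policy. Then the expected total cost of $B$ is at most twice that of $BA$: $$\mathrm{E}[\mathscr{C}(B)]\le 2\,\mathrm{E}[\mathscr{C}(BA)].$$
   Context: Model. A perishable product has a lifetime of $K$ periods; the horizon is $T$ periods; $\beta\in(0,1]$ is a discount factor. Demands $D_1,\dots,D_T\ge 0$ are exogenous random variables with finite means (possibly nonstationary and correlated). At the beginning of period $t$ one observes a realization $f_t$ of $F_t=(D_1,\dots,D_{t-1},U_1,\dots,U_t)$, where the $U_s$ are exogenous forecast information; the conditional joint law of $(D_t,\dots,D_T)$ given $f_t$ is known. The state also contains the inventory vector $\mathbf{x}_t=(x_{1,t},\dots,x_{K-1,t})$, $x_{k,t}\ge0$ being the inventory of age $k$. In period $t$ a (possibly fractional) quantity $q_t\ge0$ of age-0 product is ordered and arrives immediately; put $x_{0,t}=q_t$ and $y_t=\sum_{k=1}^{K-1}x_{k,t}+q_t$. Then $D_t$ occurs and is served oldest units first (FIFO), unmet demand is lost, all remaining units age by 1 and those reaching age $K$ are discarded (outdated): $X_{k,t+1}=\big(X_{k-1,t}-(D_t-\sum_{m=k}^{K-1}X_{m,t})^+\big)^+$, $k=1,\dots,K-1$, $t=1,\dots,T$. The initial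 inventory is zero. An ordering policy $\pi$ is a collection of decision rules $(\mathbf{x}_t,f_t)\mapsto q_t$, $t=1,\dots,T$; a superscript $\pi$ denotes quantities under $\pi$. Costs. $p,h,w\ge0$ are the unit shortage, holding and outdating costs (obtained from original costs $\hat c,\hat p,\hat h,\hat w$ with $\hat p\ge\hat c$, $\hat w+\beta\hat c\ge0$ by $p=\hat p-\hat c$, $h=\hat h+(1-\beta)\hat c$, $w=\hat w+\beta\hat c$, so that the unit ordering cost becomes 0). The total cost of $\pi$ is $\mathscr{C}(\pi)=\sum_{t=1}^T\beta^{t-1}\big(p(D_t-Y_t^\pi)^++h(Y_t^\pi-D_t)^++w(X_{K-1,t}^\pi-D_t)^+\big)$. Base-stock policies. A base-stock policy with level $S\ge0$ raises the total inventory to the same level $S$ in each period, i.e. $q_t=S-\sum_{k=1}^{K-1}x_{k,t}$. An optimal base-stock policy $BA$ is one minimizing the expected total cost $\mathrm{E}[\mathscr{C}(\cdot)]$ among base-stock policies. Marginal costs. Given $\mathbf{x}_t,f_t,q_t$, let $A_{0,t}=0$ and $A_{k,t}=(A_{k-1,t}+D_{t+k-1}-x_{K-k,t})^+$ for $k=1,\dots,K-1$. Define $P_t(\mathbf{x}_t,f_t,q_t)=\beta^{t-1}p\,\mathrm{E}[(D_t-y_t)^+|f_t]$; $H_t(\mathbf{x}_t,f_t,q_t)=\sum_{k=0}^{K-1}\beta^{t+k-1}h\,\mathrm{E}[(q_t-(A_{k,t}+D_{t+k}-\sum_{m=1}^{K-k-1}x_{m,t})^+)^+|f_t]$, the sum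 over $k$ running only to $T-t$ when $t+K-1\ge T$; $W_t(\mathbf{x}_t,f_t,q_t)=\beta^{t+K-2}w\,\mathrm{E}[(q_t-A_{K-1,t}-D_{t+K-1})^+|f_t]$ for $t\le T-K+1$ and $W_t=0$ for $t\ge T-K+2$. *)

theory Defs
  imports "HOL-Probability.Probability"
begin

definition pos :: "real \<Rightarrow> real" where
  "pos a = max a 0"

section \<open>Inventory dynamics along a sample path\<close>

text \<open>An inventory vector lists the stock of ages \<open>1, \<dots>, K - 1\<close>; it is a function that is
  \<open>undefined\<close> outside \<open>{1..<K}\<close>.\<close>

type_synonym inv_vec = "nat \<Rightarrow> real"

text \<open>The information available in period \<open>t\<close> is the pair of past demands and of
  forecast information revealed so far, including that of period \<open>t\<close>.\<close>

type_synonym 'u info = "(nat \<Rightarrow> real) \<times> (nat \<Rightarrow> 'u)"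

type_synonym 'u policy = "nat \<Rightarrow> inv_vec \<Rightarrow> 'u info \<Rightarrow> real"

definition info :: "(nat \<Rightarrow> real) \<Rightarrow> (nat \<Rightarrow> 'u) \<Rightarrow> nat \<Rightarrow> 'u info" where
  "info d u t = (restrict d {1..<t}, restrict u {1..t})"

text \<open>The vector \<open>x(0 := q)\<close> adds the newly arrived units, of age 0, to the stock \<open>x\<close>.\<close>

definition fifo_step :: "nat \<Rightarrow> inv_vec \<Rightarrow> real \<Rightarrow> real \<Rightarrow> inv_vec" where
  "fifo_step K x q d =
     (\<lambda>k\<in>{1..<K}. pos ((x(0 := q)) (k - 1) - pos (d - (\<Sum>m=k..K-1. (x(0 := q)) m))))"

text \<open>Periods are numbered from 1, and the inventory at the beginning of period 1 is zero; the
  value at the index 0 is not used.\<close>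

primrec inventory ::
  "nat \<Rightarrow> 'u policy \<Rightarrow> (nat \<Rightarrow> real) \<Rightarrow> (nat \<Rightarrow> 'u) \<Rightarrow> nat \<Rightarrow> inv_vec" where
  "inventory K \<pi> d u 0 = (\<lambda>k\<in>{1..<K}. 0)"
| "inventory K \<pi> d u (Suc t) =
     (if t = 0 then (\<lambda>k\<in>{1..<K}. 0)
      else fifo_step K (inventory K \<pi> d u t)
             (\<pi> t (inventory K \<pi> d u t) (info d u t)) (d t))"

definition order_qty :: "nat \<Rightarrow> 'u policy \<Rightarrow> (nat \<Rightarrow> real) \<Rightarrow> (nat \<Rightarrow> 'u) \<Rightarrow> nat \<Rightarrow> real" where
  "order_qty K \<pi> d u t = \<pi> t (inventory K \<pi> d u t) (info d u t)"

definition stock_by_age ::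
  "nat \<Rightarrow> 'u policy \<Rightarrow> (nat \<Rightarrow> real) \<Rightarrow> (nat \<Rightarrow> 'u) \<Rightarrow> nat \<Rightarrow> nat \<Rightarrow> real" where
  "stock_by_age K \<pi> d u t = (inventory K \<pi> d u t)(0 := order_qty K \<pi> d u t)"

definition total_stock :: "nat \<Rightarrow> inv_vec \<Rightarrow> real \<Rightarrow> real" where
  "total_stock K x q = (\<Sum>k=1..K-1. x k) + q"

definition total_cost ::
  "nat \<Rightarrow> nat \<Rightarrow> real \<Rightarrow> real \<Rightarrow> real \<Rightarrow> real \<Rightarrow> 'u policy \<Rightarrow> (nat \<Rightarrow> real) \<Rightarrow> (nat \<Rightarrow> 'u) \<Rightarrow> real" where
  "total_cost K T \<beta> p h w \<pi> d u =
     (\<Sum>t=1..T. \<beta> ^ (t - 1) *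
        (let y = total_stock K (inventory K \<pi> d u t) (order_qty K \<pi> d u t)
         in p * pos (d t - y) + h * pos (y - d t)
            + w * pos (stock_by_age K \<pi> d u t (K - 1) - d t)))"

section \<open>Probabilistic model\<close>

definition info_space :: "(nat \<Rightarrow> 'u measure) \<Rightarrow> nat \<Rightarrow> 'u info measure" where
  "info_space N t = PiM {1..<t} (\<lambda>_. borel) \<Otimes>\<^sub>M PiM {1..t} N"

definition info_rv ::
  "(nat \<Rightarrow> 'a \<Rightarrow> real) \<Rightarrow> (nat \<Rightarrow> 'a \<Rightarrow> 'u) \<Rightarrow> nat \<Rightarrow> 'a \<Rightarrow> 'u info" where
  "info_rv D U t \<omega> = info (\<lambda>s. D s \<omega>) (\<lambda>s. U s \<omega>) t"

text \<open>The kernel \<open>\<kappa>\<close> is a regular conditional distribution of \<open>Z\<close>, with values in \<open>L\<close>, given \<open>Y\<close>,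
  with values in \<open>N\<close>.\<close>

definition is_cond_law ::
  "'a measure \<Rightarrow> ('a \<Rightarrow> 'b) \<Rightarrow> 'b measure \<Rightarrow> ('a \<Rightarrow> 'c) \<Rightarrow> 'c measure \<Rightarrow> ('b \<Rightarrow> 'c measure) \<Rightarrow> bool" where
  "is_cond_law M Y N Z L \<kappa> \<longleftrightarrow>
     \<kappa> \<in> measurable N (prob_algebra L) \<and>
     (\<forall>A\<in>sets N. \<forall>C\<in>sets L.
        emeasure M {\<omega> \<in> space M. Y \<omega> \<in> A \<and> Z \<omega> \<in> C} =
        (\<integral>\<^sup>+ \<omega>. emeasure (\<kappa> (Y \<omega>)) C * indicator A (Y \<omega>) \<partial>M))"

text \<open>The expectation is taken in the extended nonnegative reals, so that a policy of infinite
  expected cost is not assigned the junk value 0 of the Bochner integral.\<close>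

definition expected_cost ::
  "'a measure \<Rightarrow> (nat \<Rightarrow> 'a \<Rightarrow> real) \<Rightarrow> (nat \<Rightarrow> 'a \<Rightarrow> 'u) \<Rightarrow>
   nat \<Rightarrow> nat \<Rightarrow> real \<Rightarrow> real \<Rightarrow> real \<Rightarrow> real \<Rightarrow> 'u policy \<Rightarrow> ennreal" where
  "expected_cost M D U K T \<beta> p h w \<pi> =
     (\<integral>\<^sup>+ \<omega>. ennreal (total_cost K T \<beta> p h w \<pi> (\<lambda>s. D s \<omega>) (\<lambda>s. U s \<omega>)) \<partial>M)"

definition states :: "nat \<Rightarrow> inv_vec set" where
  "states K = PiE {1..<K} (\<lambda>_. {0..})"

definition ordering_policy :: "(nat \<Rightarrow> 'u measure) \<Rightarrow> nat \<Rightarrow> nat \<Rightarrow> 'u policy \<Rightarrow> bool" where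
  "ordering_policy N K T \<pi> \<longleftrightarrow>
     (\<forall>t\<in>{1..T}.
        (\<lambda>(x, f). \<pi> t x f) \<in>
          borel_measurable (PiM {1..<K} (\<lambda>_. borel) \<Otimes>\<^sub>M info_space N t) \<and>
        (\<forall>x\<in>states K. \<forall>f\<in>space (info_space N t). 0 \<le> \<pi> t x f))"

section \<open>Base-stock policies\<close>

text \<open>The order quantity is negative only in states holding more than \<open>S\<close> units. These are never
  reached from zero initial inventory, see \<open>base_stock_order_nonneg\<close> below.\<close>

definition base_stock :: "nat \<Rightarrow> real \<Rightarrow> 'u policy" where
  "base_stock K S = (\<lambda>t x f. S - (\<Sum>k=1..K-1. x k))"

definition optimal_base_stock ::
  "'a measure \<Rightarrow> (nat \<Rightarrow> 'a \<Rightarrow> real) \<Rightarrow> (nat \<Rightarrow> 'a \<Rightarrow> 'u) \<Rightarrow>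
   nat \<Rightarrow> nat \<Rightarrow> real \<Rightarrow> real \<Rightarrow> real \<Rightarrow> real \<Rightarrow> 'u policy \<Rightarrow> bool" where
  "optimal_base_stock M D U K T \<beta> p h w \<pi> \<longleftrightarrow>
     (\<exists>S\<ge>0. \<pi> = base_stock K S \<and>
        (\<forall>S'\<ge>0. expected_cost M D U K T \<beta> p h w (base_stock K S)
              \<le> expected_cost M D U K T \<beta> p h w (base_stock K S')))"

lemma base_stock_order_nonneg:
  assumes "0 \<le> S"
  shows "0 \<le> order_qty K (base_stock K S) d u t"
proof -
  have "(\<forall>k\<in>{1..<K}. 0 \<le> inventory K (base_stock K S) d u t k) \<and>
        (\<Sum>k=1..K-1. inventory K (base_stock K S) d u t k) \<le> S" for t
  proof (induction t)
    case 0
    have "(\<Sum>k=1..K-1. inventory K (base_stock K S) d u 0 k) = 0"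
      by (rule sum.neutral) auto
    then show ?case using assms by auto
  next
    case (Suc t)
    show ?case
    proof (cases "t = 0")
      case True
      have "(\<Sum>k=1..K-1. inventory K (base_stock K S) d u (Suc t) k) = 0"
        by (rule sum.neutral) (auto simp: True)
      then show ?thesis using assms by (auto simp: True)
    next
      case False
      define x where "x = inventory K (base_stock K S) d u t"
      define q where "q = S - (\<Sum>k=1..K-1. x k)"
      define z where "z = x(0 := q)"
      have q: "0 \<le> q" and x: "\<And>k. k \<in> {1..<K} \<Longrightarrow> 0 \<le> x k"
        using Suc by (auto simp: q_def x_def)
      have z: "0 \<le> z k" if "k < K" for k
        using q x that by (cases "k = 0") (auto simp: z_def)
      have step: "inventory K (base_stock K S) d u (Suc t) = fifo_step K x q (d t)"
        using False by (simp add: x_def q_def base_stock_def)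
      have bound: "fifo_step K x q (d t) k \<le> z (k - 1)" if "k \<in> {1..<K}" for k
        using z[of "k - 1"] that by (auto simp: fifo_step_def pos_def z_def[symmetric])
      have nonneg: "\<forall>k\<in>{1..<K}. 0 \<le> fifo_step K x q (d t) k"
        by (simp add: fifo_step_def pos_def)
      have "(\<Sum>k=1..K-1. fifo_step K x q (d t) k) \<le> (\<Sum>k=1..K-1. z (k - 1))"
        by (intro sum_mono bound) auto
      also have "\<dots> = (\<Sum>k<K-1. z k)"
        by (rule sum.reindex_bij_witness[of _ Suc "\<lambda>k. k - 1"]) auto
      also have "\<dots> \<le> (\<Sum>k\<in>insert 0 {1..K-1}. z k)"
      proof (rule sum_mono2)
        show "finite (insert 0 {1..K-1})" by simp
        show "{..<K-1} \<subseteq> insert 0 {1..K-1}" by auto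
        show "0 \<le> z k" if "k \<in> insert 0 {1..K-1} - {..<K-1}" for k
          using that z[of k] q by (cases "k = 0") (auto simp: z_def)
      qed
      also have "\<dots> = q + (\<Sum>k=1..K-1. x k)"
        by (simp add: z_def)
      also have "\<dots> = S" by (simp add: q_def)
      finally show ?thesis using nonneg step by simp
    qed
  qed
  then show ?thesis by (simp add: order_qty_def base_stock_def)
qed

section \<open>Marginal costs and dual balancing\<close>

text \<open>The value at \<open>k\<close> is the part of the demand of periods \<open>t, \<dots>, t + k - 1\<close> that is left to younger units after
  the \<open>k\<close> oldest ages present at \<open>t\<close> have been used or have expired.\<close>

primrec residual_demand :: "nat \<Rightarrow> inv_vec \<Rightarrow> (nat \<Rightarrow> real) \<Rightarrow> nat \<Rightarrow> nat \<Rightarrow> real" where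
  "residual_demand K x d t 0 = 0"
| "residual_demand K x d t (Suc k) =
     pos (residual_demand K x d t k + d (t + k) - x (K - Suc k))"

text \<open>In the following, \<open>\<mu>\<close> is the conditional joint law of the demands of periods \<open>t, \<dots>, T\<close> given
  the observed information \<open>f\<close>; the marginal costs depend on \<open>f\<close> only through it.\<close>

definition marginal_shortage ::
  "nat \<Rightarrow> real \<Rightarrow> real \<Rightarrow> (nat \<Rightarrow> real) measure \<Rightarrow> nat \<Rightarrow> inv_vec \<Rightarrow> real \<Rightarrow> ennreal" where
  "marginal_shortage K \<beta> p \<mu> t x q =
     ennreal (\<beta> ^ (t - 1) * p) * (\<integral>\<^sup>+ d. ennreal (pos (d t - total_stock K x q)) \<partial>\<mu>)"

definition marginal_holding ::
  "nat \<Rightarrow> nat \<Rightarrow> real \<Rightarrow> real \<Rightarrow> (nat \<Rightarrow> real) measure \<Rightarrow> nat \<Rightarrow> inv_vec \<Rightarrow> real \<Rightarrow> ennreal" where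
  "marginal_holding K T \<beta> h \<mu> t x q =
     (\<Sum>k=0..min (K - 1) (T - t).
        ennreal (\<beta> ^ (t + k - 1) * h) *
        (\<integral>\<^sup>+ d. ennreal (pos (q - pos (residual_demand K x d t k + d (t + k)
                                     - (\<Sum>m=1..K-k-1. x m)))) \<partial>\<mu>))"

definition marginal_outdating ::
  "nat \<Rightarrow> nat \<Rightarrow> real \<Rightarrow> real \<Rightarrow> (nat \<Rightarrow> real) measure \<Rightarrow> nat \<Rightarrow> inv_vec \<Rightarrow> real \<Rightarrow> ennreal" where
  "marginal_outdating K T \<beta> w \<mu> t x q =
     (if t + K \<le> T + 1
      then ennreal (\<beta> ^ (t + K - 2) * w) *
           (\<integral>\<^sup>+ d. ennreal (pos (q - residual_demand K x d t (K - 1) - d (t + K - 1))) \<partial>\<mu>)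
      else 0)"

text \<open>The balancing equation is required for almost every realization \<open>f\<close> of the information,
  because conditional laws are determined only up to null sets.\<close>

definition dual_balancing ::
  "'a measure \<Rightarrow> (nat \<Rightarrow> 'u measure) \<Rightarrow> (nat \<Rightarrow> 'a \<Rightarrow> real) \<Rightarrow> (nat \<Rightarrow> 'a \<Rightarrow> 'u) \<Rightarrow>
   (nat \<Rightarrow> 'u info \<Rightarrow> (nat \<Rightarrow> real) measure) \<Rightarrow>
   nat \<Rightarrow> nat \<Rightarrow> real \<Rightarrow> real \<Rightarrow> real \<Rightarrow> real \<Rightarrow> 'u policy \<Rightarrow> bool" where
  "dual_balancing M N D U \<kappa> K T \<beta> p h w \<pi> \<longleftrightarrow>
     ordering_policy N K T \<pi> \<and>
     (\<forall>t\<in>{1..T}. AE f in distr M (info_space N t) (info_rv D U t). \<forall>x\<in>states K.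
        marginal_shortage K \<beta> p (\<kappa> t f) t x (\<pi> t x f) =
        marginal_holding K T \<beta> h (\<kappa> t f) t x (\<pi> t x f)
        + marginal_outdating K T \<beta> w (\<kappa> t f) t x (\<pi> t x f))"

end

theory Submission
  imports Defs
begin

text \<open>The cost of \<open>B\<close> is attributed to its orders: each order pays for the shortage of its own period
  and for the holding and outdating of its own units. Balancing makes the two parts conditionally
  equal in every period, so the expected cost is twice that of any selection of one part per period
  that depends on the current information only. Select holding and outdating when the stock of
  \<open>B\<close> after ordering is below the base-stock level \<open>S\<close>, and shortage otherwise; the total selected cost
  is then bounded by the cost of the base-stock policy along every path. This is immediate for
  shortage. For holding, the latest selected order is made when there are at most \<open>S\<close>
  units, so at most \<open>(S - D\<^sub>s)\<^sup>+\<close> units of selected orders remain after period \<open>s\<close>. For outdating, if units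
  of an order selected in period \<open>t\<close> outdate in period \<open>t + K - 1\<close>, then between these periods \<open>B\<close>
  outdates less than \<open>S\<close> minus the demand of these periods, whereas the base-stock policy, which starts with
  \<open>S\<close> units at \<open>t\<close>, outdates at least as much. Hence the cumulative selected outdates of \<open>B\<close> never exceed
  the cumulative outdates of the base-stock policy, and discounting preserves this.\<close>

section \<open>FIFO paths\<close>

text \<open>These three definitions are the integrands of the marginal costs. They read the demands
  from period \<open>t\<close> on only, so they can be evaluated on actual paths and on samples of
  the conditional law alike.\<close>

definition realized_shortage ::
  "nat \<Rightarrow> real \<Rightarrow> real \<Rightarrow> nat \<Rightarrow> inv_vec \<Rightarrow> real \<Rightarrow> (nat \<Rightarrow> real) \<Rightarrow> real" where
  "realized_shortage K \<beta> p t x q d = \<beta> ^ (t - 1) * p * pos (d t - total_stock K x q)"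

definition realized_holding ::
  "nat \<Rightarrow> nat \<Rightarrow> real \<Rightarrow> real \<Rightarrow> nat \<Rightarrow> inv_vec \<Rightarrow> real \<Rightarrow> (nat \<Rightarrow> real) \<Rightarrow> real" where
  "realized_holding K T \<beta> h t x q d =
     (\<Sum>k=0..min (K - 1) (T - t). \<beta> ^ (t + k - 1) * h *
        pos (q - pos (residual_demand K x d t k + d (t + k) - (\<Sum>m=1..K-k-1. x m))))"

definition realized_outdating ::
  "nat \<Rightarrow> nat \<Rightarrow> real \<Rightarrow> real \<Rightarrow> nat \<Rightarrow> inv_vec \<Rightarrow> real \<Rightarrow> (nat \<Rightarrow> real) \<Rightarrow> real" where
  "realized_outdating K T \<beta> w t x q d =
     (if t + K \<le> T + 1
      then \<beta> ^ (t + K - 2) * w * pos (q - residual_demand K x d t (K - 1) - d (t + K - 1))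
      else 0)"

lemma pos_nonneg [simp]: "0 \<le> pos a"
  by (simp add: pos_def)

lemma pos_of_nonneg: "0 \<le> a \<Longrightarrow> pos a = a"
  by (simp add: pos_def)

lemma pos_mono: "a \<le> b \<Longrightarrow> pos a \<le> pos b"
  by (auto simp: pos_def)

text \<open>A single sample path whose orders are plain numbers. It serves for the balancing and the
  base-stock policy under the same demands.\<close>

locale fifo_path =
  fixes K T :: nat and q d :: "nat \<Rightarrow> real" and x :: "nat \<Rightarrow> inv_vec"
  assumes K: "1 \<le> K"
    and q_nonneg: "\<And>t. t \<in> {1..T} \<Longrightarrow> 0 \<le> q t"
    and d_nonneg: "\<And>t. t \<in> {1..T} \<Longrightarrow> 0 \<le> d t"
    and init: "x 1 = (\<lambda>k\<in>{1..<K}. 0)"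
    and step: "\<And>t. t \<in> {1..T} \<Longrightarrow> x (Suc t) = fifo_step K (x t) (q t) (d t)"
begin

section \<open>Stock by age and its evolution\<close>

definition stock :: "nat \<Rightarrow> nat \<Rightarrow> real" where
  "stock t = (x t)(0 := q t)"

definition older :: "nat \<Rightarrow> nat \<Rightarrow> real" where
  "older t k = (\<Sum>m=k..K-1. stock t m)"

text \<open>Units of age \<open>k\<close> after demand and before aging. Units of age
  \<open>K - 1\<close> about to be discarded still count, as they do in the holding cost.\<close>

definition left :: "nat \<Rightarrow> nat \<Rightarrow> real" where
  "left t k = pos (stock t k - pos (d t - older t (Suc k)))"

definition outdated :: "nat \<Rightarrow> real" where
  "outdated t = pos (stock t (K - 1) - d t)"

lemma outdated_nonneg: "0 \<le> outdated t"
  by (simp add: outdated_def)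

lemma stock_Suc:
  assumes "t \<in> {1..T}" "Suc k < K"
  shows "stock (Suc t) (Suc k) = left t k"
  using assms by (simp add: stock_def left_def older_def step fifo_step_def)

lemma x_nonneg:
  assumes "t \<in> {1..T}" "k \<in> {1..<K}"
  shows "0 \<le> x t k"
proof (cases "t = 1")
  case True
  then show ?thesis using assms init by simp
next
  case False
  then obtain s where "t = Suc s" "s \<in> {1..T}" using assms by (cases t) auto
  then show ?thesis using assms step[of s] by (simp add: fifo_step_def)
qed

lemma stock_nonneg:
  assumes "t \<in> {1..T}" "k < K"
  shows "0 \<le> stock t k"
  using assms x_nonneg[of t k] q_nonneg by (cases "k = 0") (auto simp: stock_def)

lemma older_rec: "k < K \<Longrightarrow> older t k = stock t k + older t (Suc k)"
  by (simp add: older_def sum.atLeast_Suc_atMost)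

lemma older_K [simp]: "older t K = 0"
  using K by (simp add: older_def)

lemma older_nonneg: "t \<in> {1..T} \<Longrightarrow> 0 \<le> older t k"
  unfolding older_def by (intro sum_nonneg stock_nonneg) (use K in auto)

lemma older_0: "older t 0 = total_stock K (x t) (q t)"
proof -
  have "(\<Sum>m=1..K-1. stock t m) = (\<Sum>m=1..K-1. x t m)"
    by (intro sum.cong) (auto simp: stock_def)
  then show ?thesis
    using K older_rec[of 0 t] by (simp add: total_stock_def older_def stock_def)
qed

text \<open>Under FIFO the ages from \<open>k\<close> on are served before any younger unit, so
  \<open>pos (older t k - d t)\<close> of them remain. Age \<open>k\<close> is the difference of two
  consecutive tails, and sums over ages telescope.\<close>

lemma left_eq:
  assumes "t \<in> {1..T}" "k < K"
  shows "left t k = pos (older t k - d t) - pos (older t (Suc k) - d t)"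
  using assms stock_nonneg[of t k] older_rec[of k t] older_nonneg[of t "Suc k"] d_nonneg[of t]
  by (auto simp: left_def pos_def)

lemma sum_left:
  assumes "t \<in> {1..T}" "k \<le> K"
  shows "(\<Sum>m=k..<K. left t m) = pos (older t k - d t)"
  using assms(2)
proof (induction rule: inc_induct)
  case base
  then show ?case using d_nonneg[OF assms(1)] by (simp add: pos_def)
next
  case (step k)
  then show ?case using left_eq[OF assms(1), of k] by (simp add: sum.atLeast_Suc_lessThan)
qed

lemma outdated_eq:
  assumes "t \<in> {1..T}"
  shows "outdated t = left t (K - 1)" "outdated t = pos (older t (K - 1) - d t)"
proof -
  show "outdated t = left t (K - 1)"
    using K d_nonneg[OF assms] by (simp add: outdated_def left_def pos_def)
  show "outdated t = pos (older t (K - 1) - d t)"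
    using older_rec[of "K - 1" t] K by (simp add: outdated_def)
qed

text \<open>Aging shifts the leftover tail by one. Its units of age \<open>K - 1\<close> drop out,
  and the new order has age 0, so it does not enter.\<close>

lemma older_Suc:
  assumes t: "t \<in> {1..T}" and k: "k < K"
  shows "older (Suc t) (Suc k) = pos (older t k - d t) - outdated t"
proof -
  have "older (Suc t) (Suc k) = (\<Sum>m=Suc k..<Suc (K-1). stock (Suc t) m)"
    by (simp add: older_def atLeastLessThanSuc_atLeastAtMost)
  also have "\<dots> = (\<Sum>m=k..<K-1. left t m)"
    unfolding sum.shift_bounds_Suc_ivl using t by (intro sum.cong) (auto simp: stock_Suc)
  also have "\<dots> = (\<Sum>m=k..<K. left t m) - left t (K - 1)"
    using k sum.atLeastLessThan_Suc[of k "K-1" "left t"] by simp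
  finally show ?thesis using sum_left[OF t, of k] outdated_eq(1)[OF t] k by simp
qed

lemma older_Suc_le:
  assumes t: "t \<in> {1..T}" and k: "k < K"
  shows "older (Suc t) (Suc k) \<le> older t k"
  using older_Suc[OF assms] older_nonneg[OF t, of k] d_nonneg[OF t]
  by (auto simp: pos_def outdated_def)

text \<open>Orders placed after \<open>t\<close> are younger than \<open>k\<close> in period
  \<open>t + k\<close>, so the tail consists of units already present at \<open>t\<close>.\<close>

lemma older_add_le:
  assumes "1 \<le> t" "t + k \<le> T" "k < K"
  shows "older (t + k) k \<le> older t 0"
  using assms(2,3)
proof (induction k)
  case (Suc k)
  then show ?case using older_Suc_le[of "t + k" k] assms(1) by simp
qed simp

text \<open>Such units would have been ordered before period 1, and the initial inventory is
  zero.\<close>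

lemma stock_unreached:
  assumes "1 \<le> t" "t \<le> T" "t \<le> k" "k < K"
  shows "stock t k = 0"
  using assms
proof (induction t arbitrary: k rule: dec_induct)
  case base
  then show ?case using init by (simp add: stock_def)
next
  case (step t)
  obtain j where j: "k = Suc j" using step by (cases k) auto
  have "stock t j = 0" using step j by auto
  then show ?case using step j by (simp add: stock_Suc left_def pos_def)
qed

lemma left_unreached:
  assumes "1 \<le> t" "t \<le> T" "t \<le> k" "k < K"
  shows "left t k = 0"
  using stock_unreached[OF assms] by (simp add: left_def pos_def)

section \<open>Residual demand and the fate of a single order\<close>

lemma residual_nonneg: "0 \<le> residual_demand K y e t k"
  by (cases k) auto

text \<open>The \<open>k\<close> oldest ages present at \<open>t\<close> have left the system by period \<open>t + k\<close>; what
  they do not serve of the demand reduces the younger units, oldest first.\<close>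

lemma older_residual:
  assumes t: "1 \<le> t" and "t + k \<le> T" "j + k < K"
  shows "older (t + k) (j + k) =
    pos ((\<Sum>m=j..K-1-k. stock t m) - residual_demand K (x t) d t k)"
  using assms(2,3)
proof (induction k arbitrary: j)
  case 0
  then show ?case using older_nonneg[of t j] t by (simp add: older_def pos_def)
next
  case (Suc k)
  define a where "a = residual_demand K (x t) d t k"
  define X where "X = x t (K - Suc k)"
  define s where "s = (\<Sum>m=j..K-1-Suc k. stock t m)"
  have s0: "0 \<le> s" unfolding s_def using t Suc by (intro sum_nonneg stock_nonneg) auto
  have a0: "0 \<le> a" by (simp add: a_def residual_nonneg)
  have tk: "t + k \<in> {1..T}" using t Suc by auto
  have d0: "0 \<le> d (t + k)" using d_nonneg[OF tk] .
  have last: "K - 1 - k = Suc (K - 1 - Suc k)" using Suc by simp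
  have X: "stock t (K - 1 - k) = X" using Suc by (auto simp: stock_def X_def)
  have X0: "0 \<le> X" using stock_nonneg[of t "K - 1 - k"] X t Suc by simp
  have IH1: "older (t + k) (j + k) = pos (s + X - a)"
  proof -
    have "(\<Sum>m=j..K-1-k. stock t m) = s + X"
      using Suc.prems X unfolding last s_def by (subst sum.nat_ivl_Suc') auto
    then show ?thesis using Suc.IH[of j] Suc.prems by (simp add: a_def)
  qed
  \<comment> \<open>The \<open>X\<close> units that were the oldest still relevant at
    \<open>t\<close> have reached age \<open>K - 1\<close>. Whatever demand leaves of them outdates
    now, hence the term subtracted next.\<close>
  have "older (t + k) (K - 1) = pos (X - a)"
    using Suc.IH[of "K - 1 - k"] Suc.prems X by (simp add: a_def)
  then have "older (Suc (t + k)) (Suc (j + k)) =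
      pos (pos (s + X - a) - d (t + k)) - pos (pos (X - a) - d (t + k))"
    using older_Suc[OF tk, of "j + k"] outdated_eq(2)[OF tk] Suc.prems IH1 by simp
  also have "\<dots> = pos (s - pos (a + d (t + k) - X))"
    using s0 a0 d0 X0 by (auto simp: pos_def)
  finally show ?case by (simp add: s_def a_def X_def)
qed

text \<open>The order of period \<open>t\<close> has age \<open>k\<close> in period
  \<open>t + k\<close>, so its leftover is a difference of two tails known from
  \<open>older_residual\<close>. This identifies the summands of \<open>realized_holding\<close> as
  units physically held.\<close>

lemma left_residual:
  assumes t: "1 \<le> t" and tk: "t + k \<le> T" and k: "k < K"
  shows "left (t + k) k =
    pos (q t - pos (residual_demand K (x t) d t k + d (t + k) - (\<Sum>m=1..K-k-1. x t m)))"
proof -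
  define a where "a = residual_demand K (x t) d t k"
  define s where "s = (\<Sum>m=1..K-1-k. x t m)"
  have s: "(\<Sum>m=1..K-1-k. stock t m) = s"
    unfolding s_def by (intro sum.cong) (auto simp: stock_def)
  have s0: "0 \<le> s" unfolding s_def using t tk by (intro sum_nonneg x_nonneg) auto
  have a0: "0 \<le> a" by (simp add: a_def residual_nonneg)
  have mem: "t + k \<in> {1..T}" using t tk by auto
  have d0: "0 \<le> d (t + k)" using d_nonneg[OF mem] .
  have q0: "0 \<le> q t" using q_nonneg[of t] t tk by simp
  have "(\<Sum>m=0..K-1-k. stock t m) = q t + s"
    using s by (simp add: sum.atLeast_Suc_atMost stock_def)
  then have o0: "older (t + k) k = pos (q t + s - a)"
    using older_residual[of t k 0] t tk k by (simp add: a_def)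
  have o1: "older (t + k) (Suc k) = pos (s - a)"
  proof (cases "Suc k < K")
    case True
    then show ?thesis using older_residual[of t k 1] t tk s by (simp add: a_def)
  next
    \<comment> \<open>For the oldest age the tail above it is empty, a case outside the range of
      \<open>older_residual\<close>.\<close>
    case False
    then have "Suc k = K" using k by simp
    then show ?thesis using a0 unfolding s_def by (auto simp: pos_def)
  qed
  have "left (t + k) k = pos (q t - pos (a + d (t + k) - s))"
    unfolding left_eq[OF mem k] o0 o1 using s0 a0 d0 q0 by (simp add: pos_def max_def)
  then show ?thesis by (simp add: a_def s_def)
qed

text \<open>Conservation: units present at \<open>t\<close> and gone later were outdated or sold,
  and sales are at most the demand. Orders after \<open>t\<close> are too young to outdate within
  these at most \<open>K\<close> periods.\<close>

lemma sum_outdated_ge: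
  assumes t: "1 \<le> t" and "t + k \<le> Suc T" "k \<le> K"
  shows "older t 0 \<le> (\<Sum>i<k. outdated (t + i)) + (\<Sum>i<k. d (t + i)) + older (t + k) k"
  using assms(2,3)
proof (induction k)
  case (Suc k)
  have "older (t + k) k - d (t + k) \<le> older (Suc (t + k)) (Suc k) + outdated (t + k)"
    using older_Suc[of "t + k" k] t Suc by (simp add: pos_def)
  then show ?case using Suc by simp
qed simp

text \<open>While units from \<open>t\<close> remain, FIFO has served the whole demand from the
  units of \<open>t\<close>. Sales therefore equal demand, and conservation gives the reverse
  bound.\<close>

lemma sum_outdated_le:
  assumes t: "1 \<le> t" and "t + k \<le> T" "k < K" "0 < older (t + k) k"
  shows "(\<Sum>i<k. outdated (t + i)) + (\<Sum>i<k. d (t + i)) + older (t + k) k \<le> older t 0"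
  using assms(2-)
proof (induction k)
  case (Suc k)
  have mem: "t + k \<in> {1..T}" using t Suc by auto
  have pos: "0 < pos (older (t + k) k - d (t + k))"
    using older_Suc[OF mem, of k] Suc.prems outdated_nonneg[of "t + k"] by simp
  \<comment> \<open>A positive remainder propagates backwards, which provides the premise of the
    induction hypothesis.\<close>
  then have "d (t + k) < older (t + k) k" by (simp add: pos_def split: if_splits)
  then show ?case using Suc older_Suc[OF mem, of k] d_nonneg[OF mem] by (simp add: pos_def)
qed simp

section \<open>Attribution of the cost to the orders\<close>

definition path_cost :: "real \<Rightarrow> real \<Rightarrow> real \<Rightarrow> real \<Rightarrow> real" where
  "path_cost \<beta> p h w =
     (\<Sum>t=1..T. \<beta> ^ (t - 1) *
        (p * pos (d t - older t 0) + h * pos (older t 0 - d t) + w * outdated t))"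

text \<open>A weight \<open>c\<close> per ordering period is regrouped by the period
  \<open>s\<close> in which units are held. Units of age \<open>k\<close> were ordered in
  \<open>s - k\<close>, and \<open>k < s\<close> keeps this period at least 1.\<close>

lemma sum_realized_holding:
  "(\<Sum>t=1..T. c t * realized_holding K T \<beta> h t (x t) (q t) d) =
   (\<Sum>s=1..T. \<beta> ^ (s - 1) * h * (\<Sum>k<min K s. c (s - k) * left s k))"
proof -
  have "(\<Sum>t=1..T. c t * realized_holding K T \<beta> h t (x t) (q t) d) =
      (\<Sum>t=1..T. \<Sum>k=0..min (K - 1) (T - t). \<beta> ^ (t + k - 1) * h * (c t * left (t + k) k))"
    unfolding realized_holding_def sum_distrib_left
  proof (intro sum.cong refl)
    fix t k assume "t \<in> {1..T}" "k \<in> {0..min (K - 1) (T - t)}"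
    then have "left (t + k) k = pos (q t - pos (residual_demand K (x t) d t k + d (t + k)
        - (\<Sum>m=1..K-k-1. x t m)))"
      using K by (intro left_residual) auto
    then show "c t * (\<beta> ^ (t + k - 1) * h * pos (q t - pos (residual_demand K (x t) d t k
        + d (t + k) - (\<Sum>m=1..K-k-1. x t m)))) = \<beta> ^ (t + k - 1) * h * (c t * left (t + k) k)"
      by simp
  qed
  also have "\<dots> = (\<Sum>(t, k)\<in>Sigma {1..T} (\<lambda>t. {0..min (K - 1) (T - t)}).
      \<beta> ^ (t + k - 1) * h * (c t * left (t + k) k))"
    by (rule sum.Sigma) auto
  also have "\<dots> = (\<Sum>(s, k)\<in>Sigma {1..T} (\<lambda>s. {..<min K s}).
      \<beta> ^ (s - 1) * h * (c (s - k) * left s k))"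
    using K by (intro sum.reindex_bij_witness
        [of _ "\<lambda>(s, k). (s - k, k)" "\<lambda>(t, k). (t + k, k)"]) auto
  also have "\<dots> = (\<Sum>s=1..T. \<Sum>k<min K s. \<beta> ^ (s - 1) * h * (c (s - k) * left s k))"
    by (rule sum.Sigma[symmetric]) auto
  finally show ?thesis by (simp add: sum_distrib_left)
qed

lemma realized_outdating_eq:
  assumes "1 \<le> t"
  shows "realized_outdating K T \<beta> w t (x t) (q t) d =
    (if t + K \<le> T + 1 then \<beta> ^ (t + K - 2) * w * outdated (t + (K - 1)) else 0)"
proof (cases "t + K \<le> T + 1")
  case True
  have mem: "t + (K - 1) \<in> {1..T}" using True K assms by auto
  \<comment> \<open>This removes the inner \<open>pos\<close> of \<open>left_residual\<close>, whose
    sum over ages is empty at \<open>k = K - 1\<close>.\<close>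
  have "0 \<le> residual_demand K (x t) d t (K - 1) + d (t + (K - 1))"
    using residual_nonneg[of "x t" d t "K - 1"] d_nonneg[OF mem] by simp
  then have "outdated (t + (K - 1)) =
      pos (q t - residual_demand K (x t) d t (K - 1) - d (t + (K - 1)))"
    using outdated_eq(1)[OF mem] left_residual[of t "K - 1"] mem K assms
    by (simp add: pos_of_nonneg diff_diff_eq)
  then show ?thesis using True K by (simp add: realized_outdating_def)
qed (simp add: realized_outdating_def)

lemma sum_realized_outdating:
  "(\<Sum>t=1..T. c t * realized_outdating K T \<beta> w t (x t) (q t) d) =
   (\<Sum>s=1..T. \<beta> ^ (s - 1) * w * (if K \<le> s then c (s - (K - 1)) * outdated s else 0))"
proof -
  have "(\<Sum>t=1..T. c t * realized_outdating K T \<beta> w t (x t) (q t) d) =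
      (\<Sum>t\<in>{t\<in>{1..T}. t + K \<le> T + 1}. \<beta> ^ (t + K - 2) * w * (c t * outdated (t + (K - 1))))"
    by (intro sum.mono_neutral_cong_right) (auto simp: realized_outdating_eq)
  also have "\<dots> = (\<Sum>s\<in>{s\<in>{1..T}. K \<le> s}. \<beta> ^ (s - 1) * w * (c (s - (K - 1)) * outdated s))"
    using K by (intro sum.reindex_bij_witness
        [of _ "\<lambda>s. s - (K - 1)" "\<lambda>t. t + (K - 1)"])
      (auto simp: numeral_2_eq_2 Suc_diff_le)
  also have "\<dots> = (\<Sum>s=1..T. \<beta> ^ (s - 1) * w * (if K \<le> s then c (s - (K - 1)) * outdated s else 0))"
    by (intro sum.mono_neutral_cong_left) auto
  finally show ?thesis .
qed

text \<open>Both regroupings with all weights 1. No unit is missed: as the initial inventory is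
  zero, every unit held or outdated stems from an order of some period from 1 on.\<close>

lemma path_cost_realized:
  "path_cost \<beta> p h w =
    (\<Sum>t=1..T. realized_shortage K \<beta> p t (x t) (q t) d +
      (realized_holding K T \<beta> h t (x t) (q t) d + realized_outdating K T \<beta> w t (x t) (q t) d))"
proof -
  have out: "(if K \<le> s then 1 * outdated s else 0) = outdated s" if "s \<in> {1..T}" for s
    using left_unreached[of s "K - 1"] outdated_eq(1)[OF that] that K by auto
  have hold: "(\<Sum>k<min K s. 1 * left s k) = pos (older s 0 - d s)" if "s \<in> {1..T}" for s
  proof -
    have "(\<Sum>k<min K s. 1 * left s k) = (\<Sum>k\<in>{0..<K}. left s k)"
    proof (rule sum.mono_neutral_cong_left)
      show "\<forall>k\<in>{0..<K} - {..<min K s}. left s k = 0"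
        using left_unreached[of s] that by (metis Diff_iff atLeastAtMost_iff atLeastLessThan_iff
            lessThan_iff min_less_iff_conj not_le)
    qed auto
    then show ?thesis using sum_left[OF that, of 0] by simp
  qed
  have "(\<Sum>t=1..T. realized_holding K T \<beta> h t (x t) (q t) d) =
      (\<Sum>s=1..T. \<beta> ^ (s - 1) * h * pos (older s 0 - d s))"
    using sum_realized_holding[of "\<lambda>_. 1" \<beta> h] hold by simp
  moreover have "(\<Sum>t=1..T. realized_outdating K T \<beta> w t (x t) (q t) d) =
      (\<Sum>s=1..T. \<beta> ^ (s - 1) * w * outdated s)"
    using sum_realized_outdating[of "\<lambda>_. 1" \<beta> w] out by simp
  ultimately show ?thesis
    by (simp add: path_cost_def sum.distrib realized_shortage_def older_0 algebra_simps)
qed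

text \<open>Only the latest ordering period \<open>s - k\<close> with \<open>k \<in> J\<close> matters: all units counted were
  present then, and by then there were at most \<open>S\<close> units in stock.\<close>

lemma sum_left_le:
  assumes s: "s \<in> {1..T}" and J: "J \<subseteq> {..<min K s}"
    and S: "\<And>k. k \<in> J \<Longrightarrow> older (s - k) 0 \<le> S"
  shows "(\<Sum>k\<in>J. left s k) \<le> pos (S - d s)"
proof (cases "J = {}")
  case False
  have fin: "finite J" using J finite_subset by blast
  define k where "k = Min J"
  have kJ: "k \<in> J" and kmin: "\<And>j. j \<in> J \<Longrightarrow> k \<le> j"
    using fin False by (auto simp: k_def)
  have k: "k < K" "k < s" using J kJ by auto
  have "(\<Sum>k\<in>J. left s k) \<le> (\<Sum>j=k..<K. left s j)"
    using J kmin by (intro sum_mono2) (auto simp: left_def)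
  also have "\<dots> = pos (older s k - d s)" using sum_left[OF s] k by simp
  also have "\<dots> \<le> pos (S - d s)"
  proof (intro pos_mono diff_right_mono)
    have "older (s - k + k) k \<le> older (s - k) 0" using k s by (intro older_add_le) auto
    then show "older s k \<le> S" using k S[OF kJ] by simp
  qed
  finally show ?thesis .
qed simp

text \<open>Here \<open>o'\<close> stands for the outdates of the base-stock path. A period with
  selected outdating is removed together with its block of \<open>K\<close> periods, over which both
  policies are compared through \<open>S\<close> minus the demand of the block; this needs strong
  induction. Any other period adds nothing on the left.\<close>

lemma sum_outdated_prefix:
  assumes o_nonneg: "\<And>s. 0 \<le> o' s"
    and o_ge: "\<And>t. 1 \<le> t \<Longrightarrow> t + K \<le> Suc T \<Longrightarrow> S \<le> (\<Sum>i<K. o' (t + i)) + (\<Sum>i<K. d (t + i))"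
    and "n \<le> T"
  shows "(\<Sum>s=1..n. if K \<le> s \<and> older (s - (K - 1)) 0 < S then outdated s else 0)
    \<le> (\<Sum>s=1..n. o' s)" (is "sum ?a _ \<le> _")
  using \<open>n \<le> T\<close>
proof (induction n rule: less_induct)
  case (less n)
  show ?case
  proof (cases "?a n = 0 \<or> n = 0")
    case True
    show ?thesis
    proof (cases n)
      case (Suc m)
      have "?a n = 0" using True Suc by simp
      moreover have "sum ?a {1..n} = sum ?a {1..m} + ?a n" unfolding Suc by simp
      ultimately have "sum ?a {1..n} = sum ?a {1..m}" by simp
      also have "\<dots> \<le> sum o' {1..m}" using less Suc by simp
      also have "\<dots> \<le> sum o' {1..n}" using Suc o_nonneg by (intro sum_mono2) auto
      finally show ?thesis .
    qed simp
  next
    case False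
    \<comment> \<open>The period in which the units outdating in \<open>n\<close> were
      ordered.\<close>
    define t where "t = n - (K - 1)"
    have n: "K \<le> n" "older t 0 < S" "outdated n \<noteq> 0"
      using False by (auto simp: t_def split: if_splits)
    have t: "1 \<le> t" "n = t + (K - 1)" "t + K \<le> Suc T" and mem: "n \<in> {1..T}"
      using n K less.prems by (auto simp: t_def)
    have split: "sum f {1..n} = sum f {1..t-1} + (\<Sum>i<K. f (t + i))" for f :: "nat \<Rightarrow> real"
    proof -
      have "sum f {1..n} = sum f {1..t-1} + sum f {t..n}"
        using t K by (subst sum.union_disjoint[symmetric]) (auto intro!: sum.cong)
      also have "sum f {t..n} = (\<Sum>i<K. f (t + i))"
        using t K by (intro sum.reindex_bij_witness[of _ "\<lambda>i. t + i" "\<lambda>s. s - t"]) auto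
      finally show ?thesis .
    qed
    \<comment> \<open>Positive outdates show that units from \<open>t\<close> survive until
      \<open>n\<close>, as \<open>sum_outdated_le\<close> requires.\<close>
    have out: "outdated n = older n (K - 1) - d n" "0 < older n (K - 1)"
      using outdated_eq(2)[OF mem] n d_nonneg[OF mem] by (auto simp: pos_def max_def split: if_splits)
    have last: "(\<Sum>i<K. f (t + i)) = (\<Sum>i<K-1. f (t + i)) + f n" for f :: "nat \<Rightarrow> real"
      using K t(2) by (cases K) auto
    have "(\<Sum>i<K. ?a (t + i)) \<le> (\<Sum>i<K. outdated (t + i))"
      by (intro sum_mono) (auto simp: outdated_nonneg)
    also have "\<dots> \<le> S - (\<Sum>i<K. d (t + i))"
      using sum_outdated_le[of t "K - 1"] t K out n less.prems by (simp add: last)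
    also have "\<dots> \<le> (\<Sum>i<K. o' (t + i))" using o_ge[OF t(1,3)] by simp
    finally have "(\<Sum>i<K. ?a (t + i)) \<le> (\<Sum>i<K. o' (t + i))" .
    moreover have "sum ?a {1..t-1} \<le> sum o' {1..t-1}"
      using t K less.prems by (intro less.IH) auto
    ultimately show ?thesis unfolding split[of ?a] split[of o'] by (rule add_mono[rotated])
  qed
qed

end

text \<open>Summation by parts: the discount factors are nonincreasing, so the order of all prefix
  sums carries over to the discounted sums.\<close>

lemma discounted_sum_mono:
  fixes a b :: "nat \<Rightarrow> real"
  assumes \<beta>: "0 \<le> \<beta>" "\<beta> \<le> 1"
    and prefix: "\<And>n. n \<le> T \<Longrightarrow> (\<Sum>s=1..n. a s) \<le> (\<Sum>s=1..n. b s)"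
  shows "(\<Sum>s=1..T. \<beta> ^ (s - 1) * a s) \<le> (\<Sum>s=1..T. \<beta> ^ (s - 1) * b s)"
proof -
  define G where "G n = (\<Sum>s=1..n. b s - a s)" for n
  have G: "0 \<le> G n" if "n \<le> T" for n using prefix[OF that] by (simp add: G_def sum_subtractf)
  \<comment> \<open>Strengthened for the induction: the discounted difference is at least the plain
    one times the latest discount factor.\<close>
  have "\<beta> ^ (n - 1) * G n \<le> (\<Sum>s=1..n. \<beta> ^ (s - 1) * (b s - a s))" if "n \<le> T" for n
    using that
  proof (induction n)
    case (Suc n)
    have "\<beta> ^ n * G n \<le> \<beta> ^ (n - 1) * G n"
      using \<beta> G Suc.prems by (intro mult_right_mono power_decreasing) auto
    then show ?case using Suc by (simp add: G_def algebra_simps)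
  qed (simp add: G_def)
  from this[of T] have "0 \<le> (\<Sum>s=1..T. \<beta> ^ (s - 1) * (b s - a s))"
    using G[of T] \<beta> by (meson mult_nonneg_nonneg order_refl order_trans zero_le_power)
  then show ?thesis by (simp add: algebra_simps sum_subtractf)
qed

text \<open>The second path has stock \<open>S\<close> after ordering in every period. Regrouped
  holding and shortage are compared period by period, outdating only through prefix sums.\<close>

lemma selected_cost_le:
  assumes "fifo_path K T q d x" "fifo_path K T q' d x'"
    and \<beta>: "0 \<le> \<beta>" "\<beta> \<le> 1" and p: "0 \<le> p" and h: "0 \<le> h" and w: "0 \<le> w"
    and S: "\<And>t. t \<in> {1..T} \<Longrightarrow> total_stock K (x' t) (q' t) = S"
  shows "(\<Sum>t=1..T. if total_stock K (x t) (q t) < S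
      then realized_holding K T \<beta> h t (x t) (q t) d + realized_outdating K T \<beta> w t (x t) (q t) d
      else realized_shortage K \<beta> p t (x t) (q t) d)
    \<le> fifo_path.path_cost K T q' d x' \<beta> p h w"
proof -
  interpret b: fifo_path K T q d x by fact
  interpret s: fifo_path K T q' d x' by fact
  have S': "s.older t 0 = S" if "t \<in> {1..T}" for t using S[OF that] by (simp add: s.older_0)
  \<comment> \<open>These 0-1 weights, one per ordering period, turn the selection into the weighted
    sums regrouped above.\<close>
  define c where "c t = (if b.older t 0 < S then 1 else 0 :: real)" for t
  have hold: "(\<Sum>k<min K t. c (t - k) * b.left t k) \<le> pos (S - d t)" if t: "t \<in> {1..T}" for t
  proof -
    have "(\<Sum>k<min K t. c (t - k) * b.left t k) =
        (\<Sum>k\<in>{k\<in>{..<min K t}. b.older (t - k) 0 < S}. b.left t k)"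
      by (intro sum.mono_neutral_cong_right) (auto simp: c_def)
    also have "\<dots> \<le> pos (S - d t)" using t by (intro b.sum_left_le) auto
    finally show ?thesis .
  qed
  have "(\<Sum>t=1..T. c t * realized_holding K T \<beta> h t (x t) (q t) d)
      \<le> (\<Sum>t=1..T. \<beta> ^ (t - 1) * h * pos (S - d t))"
    unfolding b.sum_realized_holding using \<beta> h hold by (intro sum_mono mult_left_mono) auto
  moreover
  have out: "(\<Sum>t=1..T. c t * realized_outdating K T \<beta> w t (x t) (q t) d)
      \<le> (\<Sum>t=1..T. \<beta> ^ (t - 1) * w * s.outdated t)"
  proof -
    have "S \<le> (\<Sum>i<K. s.outdated (t + i)) + (\<Sum>i<K. d (t + i))"
      if "1 \<le> t" "t + K \<le> Suc T" for t
    \<comment> \<open>After \<open>K\<close> periods none of the \<open>S\<close> units remains in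
      stock: each was sold or outdated.\<close>
    proof -
      have "s.older (t + K) K = 0" by simp
      then show ?thesis using s.sum_outdated_ge[of t K] S'[of t] that b.K by simp
    qed
    then have "(\<Sum>t=1..T. \<beta> ^ (t - 1) *
          (if K \<le> t \<and> b.older (t - (K - 1)) 0 < S then b.outdated t else 0))
        \<le> (\<Sum>t=1..T. \<beta> ^ (t - 1) * s.outdated t)"
      by (intro discounted_sum_mono b.sum_outdated_prefix s.outdated_nonneg \<beta>) auto
    from mult_left_mono[OF this w]
    have "(\<Sum>t=1..T. w * (\<beta> ^ (t - 1) *
          (if K \<le> t \<and> b.older (t - (K - 1)) 0 < S then b.outdated t else 0)))
        \<le> (\<Sum>t=1..T. w * (\<beta> ^ (t - 1) * s.outdated t))"
      unfolding sum_distrib_left .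
    moreover have "(\<Sum>t=1..T. w * (\<beta> ^ (t - 1) *
          (if K \<le> t \<and> b.older (t - (K - 1)) 0 < S then b.outdated t else 0))) =
        (\<Sum>t=1..T. c t * realized_outdating K T \<beta> w t (x t) (q t) d)"
      unfolding b.sum_realized_outdating by (intro sum.cong) (auto simp: c_def)
    ultimately show ?thesis by (simp add: ac_simps)
  qed
  moreover
  have "(\<Sum>t=1..T. (1 - c t) * realized_shortage K \<beta> p t (x t) (q t) d)
      \<le> (\<Sum>t=1..T. \<beta> ^ (t - 1) * p * pos (d t - S))"
  proof (intro sum_mono)
    fix t
    show "(1 - c t) * realized_shortage K \<beta> p t (x t) (q t) d \<le> \<beta> ^ (t - 1) * p * pos (d t - S)"
    proof (cases "b.older t 0 < S")
      case False
      then have "pos (d t - b.older t 0) \<le> pos (d t - S)" by (intro pos_mono) auto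
      then show ?thesis using False \<beta> p
        by (auto simp: c_def realized_shortage_def b.older_0 intro!: mult_left_mono)
    qed (use \<beta> p in \<open>simp add: c_def\<close>)
  qed
  moreover have "s.path_cost \<beta> p h w = (\<Sum>t=1..T. \<beta> ^ (t - 1) * p * pos (d t - S))
      + (\<Sum>t=1..T. \<beta> ^ (t - 1) * h * pos (S - d t)) + (\<Sum>t=1..T. \<beta> ^ (t - 1) * w * s.outdated t)"
    unfolding s.path_cost_def sum.distrib[symmetric]
    by (intro sum.cong) (auto simp: S' algebra_simps)
  moreover have "(\<Sum>t=1..T. if total_stock K (x t) (q t) < S
      then realized_holding K T \<beta> h t (x t) (q t) d + realized_outdating K T \<beta> w t (x t) (q t) d
      else realized_shortage K \<beta> p t (x t) (q t) d) =
      (\<Sum>t=1..T. c t * realized_holding K T \<beta> h t (x t) (q t) d)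
      + (\<Sum>t=1..T. c t * realized_outdating K T \<beta> w t (x t) (q t) d)
      + (\<Sum>t=1..T. (1 - c t) * realized_shortage K \<beta> p t (x t) (q t) d)"
    unfolding sum.distrib[symmetric]
    by (intro sum.cong) (auto simp: c_def b.older_0)
  ultimately show ?thesis by linarith
qed

section \<open>Disintegration\<close>

text \<open>The joint law of \<open>Y\<close> and \<open>Z\<close> is a mixture of the conditional
  laws. By \<open>is_cond_law\<close> the two measures agree on rectangles, an intersection-stable
  generator, hence everywhere.\<close>

lemma cond_law_nn_integral:
  assumes M: "prob_space M" and Y[measurable]: "Y \<in> measurable M N"
    and Z[measurable]: "Z \<in> measurable M L"
    and law: "is_cond_law M Y N Z L \<kappa>"
    and g: "g \<in> borel_measurable (N \<Otimes>\<^sub>M L)"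
  shows "(\<integral>\<^sup>+ \<omega>. g (Y \<omega>, Z \<omega>) \<partial>M) = (\<integral>\<^sup>+ \<omega>. \<integral>\<^sup>+ z. g (Y \<omega>, z) \<partial>\<kappa> (Y \<omega>) \<partial>M)"
proof -
  interpret prob_space M by fact
  have k: "\<kappa> \<in> measurable N (prob_algebra L)"
    and rect: "\<And>A C. A \<in> sets N \<Longrightarrow> C \<in> sets L \<Longrightarrow>
      emeasure M {\<omega> \<in> space M. Y \<omega> \<in> A \<and> Z \<omega> \<in> C} =
      (\<integral>\<^sup>+ \<omega>. emeasure (\<kappa> (Y \<omega>)) C * indicator A (Y \<omega>) \<partial>M)"
    using law by (auto simp: is_cond_law_def)
  have ks: "sets (\<kappa> (Y \<omega>)) = sets L" if "\<omega> \<in> space M" for \<omega>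
    using measurable_space[OF k measurable_space[OF Y that]] by (simp add: space_prob_algebra)
  have k'[measurable]: "(\<lambda>\<omega>. \<kappa> (Y \<omega>)) \<in> measurable M (subprob_algebra L)"
    using measurable_compose[OF Y measurable_prob_algebraD[OF k]] .
  have Pair: "Pair (Y \<omega>) \<in> measurable (\<kappa> (Y \<omega>)) (N \<Otimes>\<^sub>M L)" if "\<omega> \<in> space M" for \<omega>
    using measurable_space[OF Y that] ks[OF that] by (simp cong: measurable_cong_sets)
  \<comment> \<open>The first coordinate is frozen at the observed value, the second is drawn from
    the kernel.\<close>
  define j where "j \<omega> = distr (\<kappa> (Y \<omega>)) (N \<Otimes>\<^sub>M L) (Pair (Y \<omega>))" for \<omega>
  have j: "j \<in> measurable M (subprob_algebra (N \<Otimes>\<^sub>M L))"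
    unfolding j_def by (rule measurable_distr2[OF _ k']) measurable
  have "distr M (N \<Otimes>\<^sub>M L) (\<lambda>\<omega>. (Y \<omega>, Z \<omega>)) = M \<bind> j"
  proof (rule measure_eqI_generator_eq[OF Int_stable_pair_measure_generator])
    show "{a \<times> b |a b. a \<in> sets N \<and> b \<in> sets L} \<subseteq> Pow (space N \<times> space L)"
      by (rule pair_measure_closed)
    show "sets (distr M (N \<Otimes>\<^sub>M L) (\<lambda>\<omega>. (Y \<omega>, Z \<omega>))) =
        sigma_sets (space N \<times> space L) {a \<times> b |a b. a \<in> sets N \<and> b \<in> sets L}"
      by (simp add: sets_pair_measure)
    show "sets (M \<bind> j) = sigma_sets (space N \<times> space L) {a \<times> b |a b. a \<in> sets N \<and> b \<in> sets L}"
      using sets_bind_measurable[OF j not_empty] by (simp add: sets_pair_measure)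
    \<comment> \<open>The whole space is itself a rectangle of finite measure, so a constant
      sequence exhausts it.\<close>
    show "range (\<lambda>_::nat. space N \<times> space L) \<subseteq> {a \<times> b |a b. a \<in> sets N \<and> b \<in> sets L}"
      by auto
    show "emeasure (distr M (N \<Otimes>\<^sub>M L) (\<lambda>\<omega>. (Y \<omega>, Z \<omega>))) (space N \<times> space L) \<noteq> \<infinity>" for i :: nat
      by (simp add: emeasure_distr)
    fix X assume "X \<in> {a \<times> b |a b. a \<in> sets N \<and> b \<in> sets L}"
    then obtain A C where X: "X = A \<times> C" and [measurable]: "A \<in> sets N" "C \<in> sets L" by auto
    have "emeasure (distr M (N \<Otimes>\<^sub>M L) (\<lambda>\<omega>. (Y \<omega>, Z \<omega>))) X =
        emeasure M {\<omega> \<in> space M. Y \<omega> \<in> A \<and> Z \<omega> \<in> C}"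
      unfolding X by (subst emeasure_distr) (auto intro!: arg_cong[where f="emeasure M"])
    also have "\<dots> = (\<integral>\<^sup>+ \<omega>. emeasure (\<kappa> (Y \<omega>)) C * indicator A (Y \<omega>) \<partial>M)"
      by (rule rect) auto
    also have "\<dots> = (\<integral>\<^sup>+ \<omega>. emeasure (j \<omega>) X \<partial>M)"
    proof (rule nn_integral_cong)
      fix \<omega> assume \<omega>: "\<omega> \<in> space M"
      have "C \<subseteq> space (\<kappa> (Y \<omega>))"
        using sets.sets_into_space[OF \<open>C \<in> sets L\<close>] sets_eq_imp_space_eq[OF ks[OF \<omega>]] by simp
      then have "Pair (Y \<omega>) -` X \<inter> space (\<kappa> (Y \<omega>)) = (if Y \<omega> \<in> A then C else {})"
        by (auto simp: X)
      then show "emeasure (\<kappa> (Y \<omega>)) C * indicator A (Y \<omega>) = emeasure (j \<omega>) X"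
        unfolding j_def by (subst emeasure_distr[OF Pair[OF \<omega>]]) (auto simp: X)
    qed
    also have "\<dots> = emeasure (M \<bind> j) X"
      by (rule emeasure_bind[symmetric, OF not_empty j]) (simp add: X)
    finally show "emeasure (distr M (N \<Otimes>\<^sub>M L) (\<lambda>\<omega>. (Y \<omega>, Z \<omega>))) X = emeasure (M \<bind> j) X" .
  qed auto
  moreover have "(\<integral>\<^sup>+ \<omega>. g (Y \<omega>, Z \<omega>) \<partial>M) =
      (\<integral>\<^sup>+ v. g v \<partial>distr M (N \<Otimes>\<^sub>M L) (\<lambda>\<omega>. (Y \<omega>, Z \<omega>)))"
    using g by (subst nn_integral_distr) auto
  ultimately have "(\<integral>\<^sup>+ \<omega>. g (Y \<omega>, Z \<omega>) \<partial>M) = (\<integral>\<^sup>+ v. g v \<partial>(M \<bind> j))"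
    by simp
  also have "\<dots> = (\<integral>\<^sup>+ \<omega>. \<integral>\<^sup>+ v. g v \<partial>j \<omega> \<partial>M)"
    by (rule nn_integral_bind[OF g j])
  also have "\<dots> = (\<integral>\<^sup>+ \<omega>. \<integral>\<^sup>+ z. g (Y \<omega>, z) \<partial>\<kappa> (Y \<omega>) \<partial>M)"
    unfolding j_def using Pair g by (intro nn_integral_cong nn_integral_distr) auto
  finally show ?thesis .
qed

text \<open>Exchanging \<open>g1\<close> and \<open>g2\<close> on an event decided by
  \<open>Y\<close> does not change the conditional integrals, by \<open>bal\<close>. So the selected
  part \<open>g\<close> and the rejected part \<open>g'\<close> have equal integrals.\<close>

lemma cond_law_balance:
  assumes M: "prob_space M" and Y[measurable]: "Y \<in> measurable M N"
    and Z[measurable]: "Z \<in> measurable M L"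
    and law: "is_cond_law M Y N Z L \<kappa>"
    and g1[measurable]: "g1 \<in> borel_measurable (N \<Otimes>\<^sub>M L)"
    and g2[measurable]: "g2 \<in> borel_measurable (N \<Otimes>\<^sub>M L)"
    and A[measurable]: "A \<in> sets N"
    and bal: "AE f in distr M N Y. (\<integral>\<^sup>+ z. g1 (f, z) \<partial>\<kappa> f) = (\<integral>\<^sup>+ z. g2 (f, z) \<partial>\<kappa> f)"
  shows "(\<integral>\<^sup>+ \<omega>. g1 (Y \<omega>, Z \<omega>) + g2 (Y \<omega>, Z \<omega>) \<partial>M) =
    2 * (\<integral>\<^sup>+ \<omega>. (if Y \<omega> \<in> A then g2 (Y \<omega>, Z \<omega>) else g1 (Y \<omega>, Z \<omega>)) \<partial>M)"
proof -
  define g where "g v = (if fst v \<in> A then g2 v else g1 v)" for v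
  define g' where "g' v = (if fst v \<in> A then g1 v else g2 v)" for v
  have [measurable]: "g \<in> borel_measurable (N \<Otimes>\<^sub>M L)" "g' \<in> borel_measurable (N \<Otimes>\<^sub>M L)"
    unfolding g_def[abs_def] g'_def[abs_def] by measurable
  have "(\<integral>\<^sup>+ \<omega>. g1 (Y \<omega>, Z \<omega>) + g2 (Y \<omega>, Z \<omega>) \<partial>M) =
      (\<integral>\<^sup>+ \<omega>. g (Y \<omega>, Z \<omega>) + g' (Y \<omega>, Z \<omega>) \<partial>M)"
    by (intro nn_integral_cong) (auto simp: g_def g'_def add.commute)
  also have "\<dots> = (\<integral>\<^sup>+ \<omega>. g (Y \<omega>, Z \<omega>) \<partial>M) + (\<integral>\<^sup>+ \<omega>. g' (Y \<omega>, Z \<omega>) \<partial>M)"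
    by (rule nn_integral_add) measurable
  also have "(\<integral>\<^sup>+ \<omega>. g' (Y \<omega>, Z \<omega>) \<partial>M) = (\<integral>\<^sup>+ \<omega>. g (Y \<omega>, Z \<omega>) \<partial>M)"
  proof -
    have "AE \<omega> in M. (\<integral>\<^sup>+ z. g1 (Y \<omega>, z) \<partial>\<kappa> (Y \<omega>)) = (\<integral>\<^sup>+ z. g2 (Y \<omega>, z) \<partial>\<kappa> (Y \<omega>))"
      using AE_distrD[OF Y bal] .
    then have "AE \<omega> in M. (\<integral>\<^sup>+ z. g' (Y \<omega>, z) \<partial>\<kappa> (Y \<omega>)) = (\<integral>\<^sup>+ z. g (Y \<omega>, z) \<partial>\<kappa> (Y \<omega>))"
    proof eventually_elim
      case (elim \<omega>)
      then show ?case by (cases "Y \<omega> \<in> A") (simp_all add: g_def g'_def)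
    qed
    then show ?thesis
      by (simp add: cond_law_nn_integral[OF M Y Z law] cong: nn_integral_cong_AE)
  qed
  finally show ?thesis by (simp add: g_def mult_2)
qed

section \<open>Measurability\<close>

lemma pos_measurable [measurable]: "pos \<in> borel_measurable borel"
  unfolding pos_def[abs_def] by measurable

lemma info_measurable:
  assumes "s \<le> t"
  shows "(\<lambda>f. info (fst f) (snd f) s) \<in> measurable (info_space N t) (info_space N s)"
proof -
  have 1: "(\<lambda>f. restrict (fst f) {1..<s}) \<in> measurable (info_space N t) (PiM {1..<s} (\<lambda>_. borel))"
    unfolding info_space_def
    by (rule measurable_compose[OF measurable_fst measurable_restrict_subset]) (use assms in auto)
  have 2: "(\<lambda>f. restrict (snd f) {1..s}) \<in> measurable (info_space N t) (PiM {1..s} N)"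
    unfolding info_space_def
    by (rule measurable_compose[OF measurable_snd measurable_restrict_subset]) (use assms in auto)
  show ?thesis unfolding info_def info_space_def[of N s] using 1 2 by (rule measurable_Pair)
qed

lemma info_rv_measurable:
  assumes "\<And>s. s \<in> {1..<t} \<Longrightarrow> D s \<in> borel_measurable M"
    and "\<And>s. s \<in> {1..t} \<Longrightarrow> U s \<in> measurable M (N s)"
  shows "info_rv D U t \<in> measurable M (info_space N t)"
  unfolding info_rv_def[abs_def] info_def info_space_def
  by (intro measurable_Pair measurable_restrict) (use assms in auto)

text \<open>Kept general in \<open>F\<close>: the results are applied on the product of information
  and demand, and with constant state and order under the conditional law.\<close>

context
  fixes X :: "'b \<Rightarrow> inv_vec" and F :: "'b measure" and K :: nat and q :: "'b \<Rightarrow> real"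
  assumes X: "X \<in> measurable F (PiM {1..<K} (\<lambda>_. borel))"
    and q[measurable]: "q \<in> borel_measurable F"
begin

lemma inv_component_measurable: "m \<in> {1..<K} \<Longrightarrow> (\<lambda>\<omega>. X \<omega> m) \<in> borel_measurable F"
  using measurable_compose[OF X measurable_component_singleton] by simp

lemma fifo_step_measurable:
  assumes [measurable]: "d \<in> borel_measurable F"
  shows "(\<lambda>\<omega>. fifo_step K (X \<omega>) (q \<omega>) (d \<omega>)) \<in> measurable F (PiM {1..<K} (\<lambda>_. borel))"
proof -
  have upd[measurable]: "(\<lambda>\<omega>. ((X \<omega>)(0 := q \<omega>)) m) \<in> borel_measurable F" if "m < K" for m
    using inv_component_measurable[of m] that by (cases "m = 0") auto
  have [measurable]: "(\<lambda>\<omega>. \<Sum>m=k..K-1. ((X \<omega>)(0 := q \<omega>)) m) \<in> borel_measurable F"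
    if "k \<in> {1..<K}" for k
    by (intro borel_measurable_sum upd) (use that in auto)
  show ?thesis
    unfolding fifo_step_def
  proof (intro measurable_restrict)
    fix k assume k: "k \<in> {1..<K}"
    then have [measurable]: "k - 1 < K" by auto
    note [measurable] = k
    show "(\<lambda>\<omega>. pos (((X \<omega>)(0 := q \<omega>)) (k - 1) -
        pos (d \<omega> - (\<Sum>m=k..K-1. ((X \<omega>)(0 := q \<omega>)) m)))) \<in> borel_measurable F"
      by measurable
  qed
qed

lemma total_stock_measurable [measurable]:
  "(\<lambda>\<omega>. total_stock K (X \<omega>) (q \<omega>)) \<in> borel_measurable F"
  unfolding total_stock_def
  by (intro borel_measurable_add borel_measurable_sum inv_component_measurable q) auto

context
  fixes e :: "'b \<Rightarrow> nat \<Rightarrow> real" and t T :: nat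
  assumes e: "\<And>s. s \<in> {t..T} \<Longrightarrow> (\<lambda>\<omega>. e \<omega> s) \<in> borel_measurable F"
    and tT: "t \<le> T"
begin

lemma residual_demand_measurable:
  "k \<le> K - 1 \<Longrightarrow> t + k \<le> Suc T \<Longrightarrow>
    (\<lambda>\<omega>. residual_demand K (X \<omega>) (e \<omega>) t k) \<in> borel_measurable F"
proof (induction k)
  case (Suc k)
  have [measurable]: "(\<lambda>\<omega>. residual_demand K (X \<omega>) (e \<omega>) t k) \<in> borel_measurable F"
    "(\<lambda>\<omega>. e \<omega> (t + k)) \<in> borel_measurable F"
    "(\<lambda>\<omega>. X \<omega> (K - Suc k)) \<in> borel_measurable F"
    using Suc by (auto intro!: e inv_component_measurable)
  show ?case by simp
qed simp

lemma realized_shortage_measurable: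
  "(\<lambda>\<omega>. realized_shortage K \<beta> p t (X \<omega>) (q \<omega>) (e \<omega>)) \<in> borel_measurable F"
proof -
  have [measurable]: "(\<lambda>\<omega>. e \<omega> t) \<in> borel_measurable F" using e tT by auto
  show ?thesis unfolding realized_shortage_def by measurable
qed

lemma leftover_measurable:
  assumes "k \<le> K - 1" "k \<le> T - t"
  shows "(\<lambda>\<omega>. pos (q \<omega> - pos (residual_demand K (X \<omega>) (e \<omega>) t k + e \<omega> (t + k)
    - (\<Sum>m=1..K-k-1. X \<omega> m)))) \<in> borel_measurable F"
proof -
  have [measurable]: "(\<lambda>\<omega>. residual_demand K (X \<omega>) (e \<omega>) t k) \<in> borel_measurable F"
    "(\<lambda>\<omega>. e \<omega> (t + k)) \<in> borel_measurable F"
    "(\<lambda>\<omega>. \<Sum>m=1..K-k-1. X \<omega> m) \<in> borel_measurable F"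
    using assms tT
    by (auto intro!: e residual_demand_measurable inv_component_measurable borel_measurable_sum)
  show ?thesis by measurable
qed

lemma realized_holding_measurable:
  "(\<lambda>\<omega>. realized_holding K T \<beta> h t (X \<omega>) (q \<omega>) (e \<omega>)) \<in> borel_measurable F"
  unfolding realized_holding_def
  by (intro borel_measurable_sum borel_measurable_times borel_measurable_const leftover_measurable)
    auto

lemma outdated_units_measurable:
  assumes "1 \<le> K" "t + K \<le> T + 1"
  shows "(\<lambda>\<omega>. pos (q \<omega> - residual_demand K (X \<omega>) (e \<omega>) t (K - 1) - e \<omega> (t + K - 1)))
    \<in> borel_measurable F"
proof -
  have [measurable]: "(\<lambda>\<omega>. residual_demand K (X \<omega>) (e \<omega>) t (K - 1)) \<in> borel_measurable F"
    "(\<lambda>\<omega>. e \<omega> (t + K - 1)) \<in> borel_measurable F"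
    using assms by (auto intro!: e residual_demand_measurable)
  show ?thesis by measurable
qed

lemma realized_outdating_measurable:
  assumes "1 \<le> K"
  shows "(\<lambda>\<omega>. realized_outdating K T \<beta> w t (X \<omega>) (q \<omega>) (e \<omega>)) \<in> borel_measurable F"
  using outdated_units_measurable[OF assms]
  by (cases "t + K \<le> T + 1") (simp_all add: realized_outdating_def borel_measurable_times)

end

end

text \<open>The information is used as if it were a path. It is undefined outside the observed
  periods, but the recursion up to \<open>s\<close> reads observed ones only.\<close>

lemma inventory_measurable:
  assumes \<pi>: "ordering_policy N K T \<pi>" and "t \<le> T" "s \<le> t"
  shows "(\<lambda>f. inventory K \<pi> (fst f) (snd f) s)
    \<in> measurable (info_space N t) (PiM {1..<K} (\<lambda>_. borel))"
  using assms(3)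
proof (induction s)
  case 0
  show ?case unfolding inventory.simps by (intro measurable_const) (auto simp: space_PiM)
next
  case (Suc s)
  show ?case
  proof (cases "s = 0")
    case True
    show ?thesis unfolding True inventory.simps if_True simp_thms
      by (intro measurable_const) (auto simp: space_PiM)
  next
    case False
    define X where "X f = inventory K \<pi> (fst f) (snd f) s" for f :: "(nat \<Rightarrow> real) \<times> (nat \<Rightarrow> 'a)"
    have X: "X \<in> measurable (info_space N t) (PiM {1..<K} (\<lambda>_. borel))"
      unfolding X_def using Suc by simp
    have pi: "(\<lambda>(x, f). \<pi> s x f) \<in> borel_measurable (PiM {1..<K} (\<lambda>_. borel) \<Otimes>\<^sub>M info_space N s)"
      using \<pi> False Suc.prems assms(2) by (simp add: ordering_policy_def)
    have q: "(\<lambda>f. \<pi> s (X f) (info (fst f) (snd f) s)) \<in> borel_measurable (info_space N t)"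
      using measurable_compose[OF measurable_Pair[OF X info_measurable[of s t N]] pi] Suc.prems
      by simp
    have d: "(\<lambda>f. fst f s) \<in> borel_measurable (info_space N t)"
      unfolding info_space_def using False Suc.prems
      by (intro measurable_compose[OF measurable_fst measurable_component_singleton]) auto
    show ?thesis using fifo_step_measurable[OF X q d] False by (simp add: X_def)
  qed
qed

section \<open>Marginal costs as integrals of realized costs\<close>

context
  fixes K T t :: nat and \<beta> :: real and \<mu> :: "(nat \<Rightarrow> real) measure" and x :: inv_vec and q :: real
  assumes \<beta>: "0 \<le> \<beta>" and \<mu>: "sets \<mu> = sets (PiM {t..T} (\<lambda>_. borel))"
    and x: "x \<in> states K" and tT: "t \<le> T"
begin

lemma const_inv_measurable: "(\<lambda>_. x) \<in> measurable \<mu> (PiM {1..<K} (\<lambda>_. borel))"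
  using x by (intro measurable_const) (auto simp: states_def space_PiM)

lemma coordinate_measurable: "s \<in> {t..T} \<Longrightarrow> (\<lambda>d. d s) \<in> borel_measurable \<mu>"
  using measurable_component_singleton[of s "{t..T}" "\<lambda>_. borel"] \<mu>
  by (simp cong: measurable_cong_sets)

lemma marginal_shortage_eq:
  assumes "0 \<le> p"
  shows "marginal_shortage K \<beta> p \<mu> t x q = (\<integral>\<^sup>+ d. ennreal (realized_shortage K \<beta> p t x q d) \<partial>\<mu>)"
proof -
  have [measurable]: "(\<lambda>d. d t) \<in> borel_measurable \<mu>" using coordinate_measurable tT by simp
  show ?thesis
    unfolding marginal_shortage_def realized_shortage_def using \<beta> assms
    by (subst nn_integral_cmult[symmetric]) (auto simp: ennreal_mult)
qed

lemma marginal_holding_eq: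
  assumes "0 \<le> h"
  shows "marginal_holding K T \<beta> h \<mu> t x q = (\<integral>\<^sup>+ d. ennreal (realized_holding K T \<beta> h t x q d) \<partial>\<mu>)"
proof -
  note meas = leftover_measurable[OF const_inv_measurable borel_measurable_const
      coordinate_measurable tT]
  have "marginal_holding K T \<beta> h \<mu> t x q = (\<Sum>k=0..min (K - 1) (T - t). \<integral>\<^sup>+ d.
      ennreal (\<beta> ^ (t + k - 1) * h * pos (q - pos (residual_demand K x d t k + d (t + k)
        - (\<Sum>m=1..K-k-1. x m)))) \<partial>\<mu>)"
    unfolding marginal_holding_def
  proof (intro sum.cong refl)
    fix k assume "k \<in> {0..min (K - 1) (T - t)}"
    then have m: "(\<lambda>d. pos (q - pos (residual_demand K x d t k + d (t + k)
        - (\<Sum>m=1..K-k-1. x m)))) \<in> borel_measurable \<mu>"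
      using meas by auto
    show "ennreal (\<beta> ^ (t + k - 1) * h) * (\<integral>\<^sup>+ d. ennreal (pos (q - pos (residual_demand K x d t k
        + d (t + k) - (\<Sum>m=1..K-k-1. x m)))) \<partial>\<mu>) = (\<integral>\<^sup>+ d.
      ennreal (\<beta> ^ (t + k - 1) * h * pos (q - pos (residual_demand K x d t k + d (t + k)
        - (\<Sum>m=1..K-k-1. x m)))) \<partial>\<mu>)"
      using \<beta> assms m by (simp add: ennreal_mult nn_integral_cmult)
  qed
  also have "\<dots> = (\<integral>\<^sup>+ d. (\<Sum>k=0..min (K - 1) (T - t).
      ennreal (\<beta> ^ (t + k - 1) * h * pos (q - pos (residual_demand K x d t k + d (t + k)
        - (\<Sum>m=1..K-k-1. x m))))) \<partial>\<mu>)"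
    by (intro nn_integral_sum[symmetric] measurable_compose[OF _ measurable_ennreal]
        borel_measurable_times borel_measurable_const meas) auto
  also have "\<dots> = (\<integral>\<^sup>+ d. ennreal (realized_holding K T \<beta> h t x q d) \<partial>\<mu>)"
    unfolding realized_holding_def using \<beta> assms by (simp add: sum_ennreal)
  finally show ?thesis .
qed

lemma marginal_outdating_eq:
  assumes "0 \<le> w" "1 \<le> K"
  shows "marginal_outdating K T \<beta> w \<mu> t x q = (\<integral>\<^sup>+ d. ennreal (realized_outdating K T \<beta> w t x q d) \<partial>\<mu>)"
proof (cases "t + K \<le> T + 1")
  case True
  have meas: "(\<lambda>d. pos (q - residual_demand K x d t (K - 1) - d (t + K - 1)))
      \<in> borel_measurable \<mu>"
    using outdated_units_measurable[OF const_inv_measurable borel_measurable_const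
      coordinate_measurable tT assms(2) True] .
  show ?thesis
    unfolding marginal_outdating_def realized_outdating_def using True \<beta> assms(1) meas
    by (simp add: ennreal_mult nn_integral_cmult)
qed (simp add: marginal_outdating_def realized_outdating_def)

end

lemma realized_nonneg:
  assumes "0 \<le> \<beta>"
  shows "0 \<le> p \<Longrightarrow> 0 \<le> realized_shortage K \<beta> p t x q d"
    and "0 \<le> h \<Longrightarrow> 0 \<le> realized_holding K T \<beta> h t x q d"
    and "0 \<le> w \<Longrightarrow> 0 \<le> realized_outdating K T \<beta> w t x q d"
  using assms by (auto simp: realized_shortage_def realized_holding_def realized_outdating_def
      intro!: sum_nonneg mult_nonneg_nonneg)

lemma residual_demand_cong:
  "(\<And>s. s \<in> {t..<t+k} \<Longrightarrow> d s = e s) \<Longrightarrow>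
    residual_demand K x d t k = residual_demand K x e t k"
  by (induction k) auto

text \<open>The conditional law lives on demands restricted to \<open>{t..T}\<close>; this allows
  the full demand path to be replaced by its restriction.\<close>

lemma realized_cong:
  assumes "\<And>s. s \<in> {t..T} \<Longrightarrow> d s = e s" and "t \<le> T" "1 \<le> K"
  shows "realized_shortage K \<beta> p t x q d = realized_shortage K \<beta> p t x q e"
    and "realized_holding K T \<beta> h t x q d = realized_holding K T \<beta> h t x q e"
    and "realized_outdating K T \<beta> w t x q d = realized_outdating K T \<beta> w t x q e"
proof -
  have *: "residual_demand K x d t k = residual_demand K x e t k" "d (t + k) = e (t + k)"
    if "k \<le> T - t" for k
    using assms that by (auto intro!: residual_demand_cong)
  show "realized_shortage K \<beta> p t x q d = realized_shortage K \<beta> p t x q e"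
    using assms by (simp add: realized_shortage_def)
  show "realized_holding K T \<beta> h t x q d = realized_holding K T \<beta> h t x q e"
    unfolding realized_holding_def by (intro sum.cong refl) (simp add: *)
  show "realized_outdating K T \<beta> w t x q d = realized_outdating K T \<beta> w t x q e"
    using *[of "K - 1"] assms(3) by (auto simp: realized_outdating_def)
qed

section \<open>Policies\<close>

lemma inventory_cong:
  assumes "\<And>s. s \<in> {1..<t} \<Longrightarrow> d s = d' s" "\<And>s. s \<in> {1..<t} \<Longrightarrow> u s = u' s"
  shows "inventory K \<pi> d u t = inventory K \<pi> d' u' t"
  using assms
proof (induction t)
  case (Suc t)
  have "info d u t = info d' u' t" unfolding info_def using Suc.prems
    by (auto intro!: restrict_ext)
  moreover have "inventory K \<pi> d u t = inventory K \<pi> d' u' t" using Suc by auto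
  ultimately show ?case using Suc.prems by (cases "t = 0") auto
qed simp

text \<open>The inventory can be recomputed from the current information, which makes state and
  order functions of the conditioning variable.\<close>

lemma inventory_info:
  "inventory K \<pi> (fst (info d u t)) (snd (info d u t)) t = inventory K \<pi> d u t"
  by (rule inventory_cong) (auto simp: info_def)

lemma inventory_in_states: "inventory K \<pi> d u t \<in> states K"
  by (cases t) (auto simp: states_def fifo_step_def)

lemma fifo_path_inventory:
  assumes "1 \<le> K" and "\<And>t. t \<in> {1..T} \<Longrightarrow> 0 \<le> order_qty K \<pi> d u t"
    and "\<And>t. t \<in> {1..T} \<Longrightarrow> 0 \<le> d t"
  shows "fifo_path K T (order_qty K \<pi> d u) d (inventory K \<pi> d u)"
  by unfold_locales (use assms in \<open>auto simp: order_qty_def\<close>)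

lemma total_cost_path:
  assumes "fifo_path K T (order_qty K \<pi> d u) d (inventory K \<pi> d u)"
  shows "total_cost K T \<beta> p h w \<pi> d u =
    fifo_path.path_cost K T (order_qty K \<pi> d u) d (inventory K \<pi> d u) \<beta> p h w"
proof -
  interpret fifo_path K T "order_qty K \<pi> d u" d "inventory K \<pi> d u" by fact
  show ?thesis
    by (simp add: total_cost_def path_cost_def older_0 outdated_def stock_def stock_by_age_def Let_def)
qed

lemma total_stock_base_stock: "total_stock K (inventory K (base_stock K S) d u t)
    (order_qty K (base_stock K S) d u t) = S"
  by (simp add: total_stock_def order_qty_def base_stock_def)

section \<open>From the pathwise comparison to expected costs\<close>

theorem theorem2:
  fixes M :: "'a measure"
    and N :: "nat \<Rightarrow> 'u measure"
    and D :: "nat \<Rightarrow> 'a \<Rightarrow> real"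
    and U :: "nat \<Rightarrow> 'a \<Rightarrow> 'u"
    and \<kappa> :: "nat \<Rightarrow> 'u info \<Rightarrow> (nat \<Rightarrow> real) measure"
    and K T :: nat
    and \<beta> p h w :: real
    and B BA :: "'u policy"
  assumes "prob_space M"
    and "K \<ge> 1"
    and "0 < \<beta>" and "\<beta> \<le> 1"
    and "0 \<le> p" and "0 \<le> h" and "0 \<le> w"
    and "\<And>t. t \<in> {1..T} \<Longrightarrow> integrable M (D t)"
    and "\<And>t. t \<in> {1..T} \<Longrightarrow> AE \<omega> in M. 0 \<le> D t \<omega>"
    and "\<And>t. t \<in> {1..T} \<Longrightarrow> U t \<in> measurable M (N t)"
    and "\<And>t. t \<in> {1..T} \<Longrightarrow>
           is_cond_law M (info_rv D U t) (info_space N t)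
             (\<lambda>\<omega>. \<lambda>s\<in>{t..T}. D s \<omega>) (PiM {t..T} (\<lambda>_. borel)) (\<kappa> t)"
    and "dual_balancing M N D U \<kappa> K T \<beta> p h w B"
    and "optimal_base_stock M D U K T \<beta> p h w BA"
  shows "expected_cost M D U K T \<beta> p h w B \<le> 2 * expected_cost M D U K T \<beta> p h w BA"
proof -
  interpret prob_space M by fact
  note K = assms(2) and \<beta> = less_imp_le[OF assms(3)] assms(4) and costs = assms(5-7)
  obtain S where S: "0 \<le> S" and BA: "BA = base_stock K S"
    using assms(13) by (auto simp: optimal_base_stock_def)
  have B: "ordering_policy N K T B" using assms(12) by (simp add: dual_balancing_def)
  define d where "d \<omega> s = D s \<omega>" for \<omega> s
  define u where "u \<omega> s = U s \<omega>" for \<omega> s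
  define x where "x \<omega> = inventory K B (d \<omega>) (u \<omega>)" for \<omega>
  define q where "q \<omega> = order_qty K B (d \<omega>) (u \<omega>)" for \<omega>
  define P where "P t \<omega> = realized_shortage K \<beta> p t (x \<omega> t) (q \<omega> t) (d \<omega>)" for t \<omega>
  define G where "G t \<omega> = realized_holding K T \<beta> h t (x \<omega> t) (q \<omega> t) (d \<omega>)
    + realized_outdating K T \<beta> w t (x \<omega> t) (q \<omega> t) (d \<omega>)" for t \<omega>
  define sel where "sel t \<omega> = (if total_stock K (x \<omega> t) (q \<omega> t) < S then G t \<omega> else P t \<omega>)" for t \<omega>
  have P0: "0 \<le> P t \<omega>" and G0: "0 \<le> G t \<omega>" for t \<omega>
    using \<beta> costs by (auto simp: P_def G_def realized_nonneg)
  then have sel0: "0 \<le> sel t \<omega>" for t \<omega> by (simp add: sel_def)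

  have D_meas: "D t \<in> borel_measurable M" if "t \<in> {1..T}" for t
    using assms(8)[OF that] by auto
  have Y_meas: "info_rv D U t \<in> measurable M (info_space N t)" if "t \<in> {1..T}" for t
    using that by (intro info_rv_measurable D_meas assms(10)) auto

  have balance: "(\<integral>\<^sup>+ \<omega>. ennreal (P t \<omega>) + ennreal (G t \<omega>) \<partial>M) = 2 * (\<integral>\<^sup>+ \<omega>. ennreal (sel t \<omega>) \<partial>M)"
    and P_meas: "(\<lambda>\<omega>. ennreal (P t \<omega>)) \<in> borel_measurable M"
    and G_meas: "(\<lambda>\<omega>. ennreal (G t \<omega>)) \<in> borel_measurable M"
    and sel_meas: "(\<lambda>\<omega>. ennreal (sel t \<omega>)) \<in> borel_measurable M"
    if t: "t \<in> {1..T}" for t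
  proof -
    define F where "F = info_space N t"
    define L :: "(nat \<Rightarrow> real) measure" where "L = PiM {t..T} (\<lambda>_. borel)"
    define Y where "Y = info_rv D U t"
    define Z where "Z \<omega> = (\<lambda>s\<in>{t..T}. D s \<omega>)" for \<omega>
    \<comment> \<open>Inventory and order of \<open>B\<close> as functions of the information
      \<open>f\<close>.\<close>
    define X where "X f = inventory K B (fst f) (snd f) t" for f
    define Q where "Q f = B t (X f) f" for f
    define g1 where "g1 v = ennreal (realized_shortage K \<beta> p t (X (fst v)) (Q (fst v)) (snd v))" for v
    define g2 where "g2 v = ennreal (realized_holding K T \<beta> h t (X (fst v)) (Q (fst v)) (snd v)
      + realized_outdating K T \<beta> w t (X (fst v)) (Q (fst v)) (snd v))" for v
    \<comment> \<open>The selection is decided by the information alone, so it is an admissible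
      event in \<open>cond_law_balance\<close>.\<close>
    define A where "A = {f \<in> space F. total_stock K (X f) (Q f) < S}"
    have law: "is_cond_law M Y F Z L (\<kappa> t)"
      using assms(11)[OF t] by (simp add: Y_def F_def Z_def[abs_def] L_def)
    have Y[measurable]: "Y \<in> measurable M F" using Y_meas[OF t] by (simp add: Y_def F_def)
    have Z[measurable]: "Z \<in> measurable M L"
      unfolding Z_def[abs_def] L_def by (intro measurable_restrict D_meas) (use t in auto)
    have X: "X \<in> measurable F (PiM {1..<K} (\<lambda>_. borel))"
      unfolding X_def[abs_def] F_def using inventory_measurable[OF B, of t t] t by simp
    have "(\<lambda>(x, f). B t x f) \<in> borel_measurable (PiM {1..<K} (\<lambda>_. borel) \<Otimes>\<^sub>M F)"
      using B t by (simp add: ordering_policy_def F_def)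
    from measurable_compose[OF measurable_Pair[OF X measurable_ident] this]
    have Q: "Q \<in> borel_measurable F" by (simp add: Q_def[abs_def])
    have A[measurable]: "A \<in> sets F"
      using total_stock_measurable[OF X Q] unfolding A_def by measurable
    have X': "(\<lambda>v. X (fst v)) \<in> measurable (F \<Otimes>\<^sub>M L) (PiM {1..<K} (\<lambda>_. borel))"
      by (rule measurable_compose[OF measurable_fst X])
    have Q': "(\<lambda>v. Q (fst v)) \<in> borel_measurable (F \<Otimes>\<^sub>M L)"
      by (rule measurable_compose[OF measurable_fst Q])
    have e: "(\<lambda>v. snd v s) \<in> borel_measurable (F \<Otimes>\<^sub>M L)" if "s \<in> {t..T}" for s
      unfolding L_def using that
      by (intro measurable_compose[OF measurable_snd measurable_component_singleton])
    have tT: "t \<le> T" using t by simp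
    have g1[measurable]: "g1 \<in> borel_measurable (F \<Otimes>\<^sub>M L)"
      unfolding g1_def[abs_def]
      by (intro measurable_compose[OF _ measurable_ennreal]
          realized_shortage_measurable[OF X' Q' e tT])
    have g2[measurable]: "g2 \<in> borel_measurable (F \<Otimes>\<^sub>M L)"
      unfolding g2_def[abs_def]
      by (intro measurable_compose[OF _ measurable_ennreal] borel_measurable_add
          realized_holding_measurable[OF X' Q' e tT]
          realized_outdating_measurable[OF X' Q' e tT K])
    have xX: "X (Y \<omega>) = x \<omega> t" for \<omega>
      by (simp add: X_def Y_def x_def d_def[abs_def] u_def[abs_def] info_rv_def inventory_info)
    have qQ: "Q (Y \<omega>) = q \<omega> t" for \<omega>
      unfolding Q_def xX by (simp add: q_def order_qty_def x_def Y_def info_rv_def d_def[abs_def] u_def[abs_def])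
    have dZ: "Z \<omega> s = d \<omega> s" if "s \<in> {t..T}" for \<omega> s
      using that by (simp add: Z_def d_def)
    have g1_eq: "g1 (Y \<omega>, Z \<omega>) = ennreal (P t \<omega>)" for \<omega>
      unfolding g1_def P_def fst_conv snd_conv xX qQ using dZ tT K
      by (intro arg_cong[where f=ennreal] realized_cong(1)[where T=T])
    have g2_eq: "g2 (Y \<omega>, Z \<omega>) = ennreal (G t \<omega>)" for \<omega>
      unfolding g2_def G_def fst_conv snd_conv xX qQ using dZ tT K
      by (intro arg_cong[where f=ennreal] arg_cong2[where f=plus] realized_cong(2,3))
    have sel_eq: "(if Y \<omega> \<in> A then g2 (Y \<omega>, Z \<omega>) else g1 (Y \<omega>, Z \<omega>)) = ennreal (sel t \<omega>)"
      if "\<omega> \<in> space M" for \<omega>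
      using measurable_space[OF Y that] by (simp add: A_def xX qQ g1_eq g2_eq sel_def)
    have "(\<lambda>\<omega>. g1 (Y \<omega>, Z \<omega>)) \<in> borel_measurable M" by measurable
    then show "(\<lambda>\<omega>. ennreal (P t \<omega>)) \<in> borel_measurable M" by (simp add: g1_eq)
    have "(\<lambda>\<omega>. g2 (Y \<omega>, Z \<omega>)) \<in> borel_measurable M" by measurable
    then show "(\<lambda>\<omega>. ennreal (G t \<omega>)) \<in> borel_measurable M" by (simp add: g2_eq)
    have "(\<lambda>\<omega>. if Y \<omega> \<in> A then g2 (Y \<omega>, Z \<omega>) else g1 (Y \<omega>, Z \<omega>)) \<in> borel_measurable M"
      by measurable
    then show "(\<lambda>\<omega>. ennreal (sel t \<omega>)) \<in> borel_measurable M"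
      by (simp add: sel_eq cong: measurable_cong)
    have "AE f in distr M F Y. \<forall>x\<in>states K.
        marginal_shortage K \<beta> p (\<kappa> t f) t x (B t x f) =
        marginal_holding K T \<beta> h (\<kappa> t f) t x (B t x f)
        + marginal_outdating K T \<beta> w (\<kappa> t f) t x (B t x f)"
      using assms(12) t unfolding dual_balancing_def F_def Y_def by blast
    moreover have "AE f in distr M F Y. f \<in> space F"
      using AE_space[of "distr M F Y"] by simp
    ultimately
    have "AE f in distr M F Y. (\<integral>\<^sup>+ z. g1 (f, z) \<partial>\<kappa> t f) = (\<integral>\<^sup>+ z. g2 (f, z) \<partial>\<kappa> t f)"
    proof eventually_elim
      case (elim f)
      have sets: "sets (\<kappa> t f) = sets (PiM {t..T} (\<lambda>_. borel))"
        using law measurable_space[of "\<kappa> t" F "prob_algebra L" f] elim(2)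
        by (simp add: is_cond_law_def space_prob_algebra L_def)
      have Xf: "X f \<in> states K" by (simp add: X_def inventory_in_states)
      note ctx = \<beta>(1) sets Xf tT
      note meas = const_inv_measurable[OF ctx] borel_measurable_const coordinate_measurable[OF ctx] tT
      have "(\<integral>\<^sup>+ z. g1 (f, z) \<partial>\<kappa> t f) = marginal_shortage K \<beta> p (\<kappa> t f) t (X f) (Q f)"
        using marginal_shortage_eq[OF ctx costs(1)] by (simp add: g1_def)
      \<comment> \<open>Off one null set the balancing equation holds for all states at once, so it
        may be used at \<open>X f\<close>, which varies with \<open>f\<close>.\<close>
      also have "\<dots> = marginal_holding K T \<beta> h (\<kappa> t f) t (X f) (Q f)
          + marginal_outdating K T \<beta> w (\<kappa> t f) t (X f) (Q f)"
        using elim(1) Xf by (simp add: Q_def)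
      also have "\<dots> = (\<integral>\<^sup>+ z. ennreal (realized_holding K T \<beta> h t (X f) (Q f) z)
          + ennreal (realized_outdating K T \<beta> w t (X f) (Q f) z) \<partial>\<kappa> t f)"
        unfolding marginal_holding_eq[OF ctx costs(2)] marginal_outdating_eq[OF ctx costs(3) K]
        by (intro nn_integral_add[symmetric] measurable_compose[OF _ measurable_ennreal]
          realized_holding_measurable[OF meas] realized_outdating_measurable[OF meas K])
      also have "\<dots> = (\<integral>\<^sup>+ z. g2 (f, z) \<partial>\<kappa> t f)"
        using \<beta> costs by (simp add: g2_def realized_nonneg)
      finally show ?case .
    qed
    from cond_law_balance[OF assms(1) Y Z law g1 g2 A this]
    show "(\<integral>\<^sup>+ \<omega>. ennreal (P t \<omega>) + ennreal (G t \<omega>) \<partial>M) = 2 * (\<integral>\<^sup>+ \<omega>. ennreal (sel t \<omega>) \<partial>M)"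
      by (simp add: g1_eq g2_eq sel_eq cong: nn_integral_cong)
  qed

  \<comment> \<open>Demands are nonnegative only almost surely; finitely many null sets are
    discarded before passing to paths.\<close>
  have "AE \<omega> in M. \<forall>t\<in>{1..T}. 0 \<le> D t \<omega>"
    using assms(9) by (intro AE_ball_countable') (auto intro: countable_finite)
  moreover have "AE \<omega> in M. \<omega> \<in> space M" by simp
  ultimately have paths: "AE \<omega> in M. fifo_path K T (q \<omega>) (d \<omega>) (x \<omega>) \<and>
    fifo_path K T (order_qty K BA (d \<omega>) (u \<omega>)) (d \<omega>) (inventory K BA (d \<omega>) (u \<omega>))"
  proof eventually_elim
    case (elim \<omega>)
    have "0 \<le> q \<omega> t" if t: "t \<in> {1..T}" for t
    proof -
      have "info (d \<omega>) (u \<omega>) t \<in> space (info_space N t)"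
        using measurable_space[OF Y_meas[OF t] elim(2)] by (simp add: info_rv_def d_def[abs_def] u_def[abs_def])
      then show ?thesis
        using B t by (auto simp: q_def order_qty_def ordering_policy_def inventory_in_states)
    qed
    then show ?case
      using elim(1) K S unfolding BA x_def q_def
      by (auto intro!: fifo_path_inventory base_stock_order_nonneg simp: d_def)
  qed

  have "expected_cost M D U K T \<beta> p h w B =
      (\<integral>\<^sup>+ \<omega>. (\<Sum>t=1..T. ennreal (P t \<omega>) + ennreal (G t \<omega>)) \<partial>M)"
    unfolding expected_cost_def
  proof (rule nn_integral_cong_AE, use paths in eventually_elim)
    case (elim \<omega>)
    then have "total_cost K T \<beta> p h w B (d \<omega>) (u \<omega>) = (\<Sum>t=1..T. P t \<omega> + G t \<omega>)"
      using total_cost_path[of K T B "d \<omega>" "u \<omega>"] fifo_path.path_cost_realized[of K T "q \<omega>" "d \<omega>" "x \<omega>"]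
      by (simp add: P_def G_def x_def q_def)
    then show ?case
      using P0 G0 by (simp add: d_def[abs_def] u_def[abs_def] sum_ennreal flip: ennreal_plus)
  qed
  also have "\<dots> = (\<Sum>t=1..T. \<integral>\<^sup>+ \<omega>. ennreal (P t \<omega>) + ennreal (G t \<omega>) \<partial>M)"
    using P_meas G_meas by (intro nn_integral_sum borel_measurable_add)
  also have "\<dots> = (\<Sum>t=1..T. 2 * (\<integral>\<^sup>+ \<omega>. ennreal (sel t \<omega>) \<partial>M))"
    by (intro sum.cong refl balance)
  also have "\<dots> = 2 * (\<integral>\<^sup>+ \<omega>. (\<Sum>t=1..T. ennreal (sel t \<omega>)) \<partial>M)"
    using sel_meas unfolding sum_distrib_left[symmetric] by (subst nn_integral_sum) auto
  \<comment> \<open>The selected sum is dominated on almost every path, with \<open>S\<close> the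
    level of \<open>BA\<close>.\<close>
  also have "\<dots> \<le> 2 * expected_cost M D U K T \<beta> p h w BA"
    unfolding expected_cost_def
  proof (rule mult_left_mono[OF nn_integral_mono_AE], use paths in eventually_elim)
    case (elim \<omega>)
    have "(\<Sum>t=1..T. sel t \<omega>) \<le> fifo_path.path_cost K T (order_qty K BA (d \<omega>) (u \<omega>)) (d \<omega>)
        (inventory K BA (d \<omega>) (u \<omega>)) \<beta> p h w"
      unfolding sel_def P_def G_def
      by (rule selected_cost_le[OF conjunct1[OF elim] conjunct2[OF elim] \<beta> costs])
        (simp add: BA total_stock_base_stock)
    then have "(\<Sum>t=1..T. sel t \<omega>) \<le> total_cost K T \<beta> p h w BA (d \<omega>) (u \<omega>)"
      using total_cost_path[OF conjunct2[OF elim]] by simp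
    then show ?case
      using sel0 by (simp add: d_def[abs_def] u_def[abs_def] sum_ennreal ennreal_leI)
  qed simp
  finally show ?thesis .
qed

end
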